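(* Let $\Phi$ be a finite irreducible crystallographic root system with associated affine root system $\widetilde\Phi$, and let $P$ be a block of a tope poset of the oriented matroid $(\widetilde\Phi,-,\mathrm{cone}_{\widetilde\Phi})$. Then $P$ is isomorphic, as a poset, to a twisted weak order $(W',\le'_B)$ on some Coxeter group $W'$ (for some biclosed set $B$ in the set of positive roots of $W'$).
   Context: Affine root system: $\Phi$ lies in a Euclidean space $V$, with positive system $\Phi^+$ and $\Phi^-=-\Phi^+$. Put $V'=V\oplus\mathbb R\delta$. For $\alpha\in\Phi^+$ let $\{\alpha\}^\wedge=\{\alpha+n\delta\mid n\in\mathbb Z_{\ge0}\}$; for $\alpha\in\Phi^-$ let $\{\alpha\}^\wedge=\{\alpha+(n+1)\delta\mid n\in\mathbb Z_{\ge0}\}$; $\Phi^\wedge=\bigcup_{\alpha\in\Phi}\{\alpha\}^\wedge$ and $\widetilde\Phi=\Phi^\wedge\uplus-\Phi^\wedge\subset V'$. For $\Gamma\subset\widetilde\Phi$, $\mathrm{cone}(\Gamma)$ is the set of all finite sums $\sum k_iv_i$ with $v_i\in\Gamma\cup\{0\}$, $k_i\in\mathbb R_{\ge0}$, and $\mathrm{cone}_{\widetilde\Phi}(\Gamma)=\mathrm{cone}(\Gamma)\cap\widetilde\Phi$. A subset is convex if it is closed under $\mathrm{cone}_{\widetilde\Phi}$. A hemispace (tope) is a convex set $F\subset\widetilde\Phi$ with $F\cap-F=\emptyset$ and $F\cup-F=\widetilde\Phi$. The tope poset based at a hemispace $H$ is the set of all hemispaces ordered by $F\le G\iff F\,\triangle\,H\subset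 G\,\triangle\,H$ ($\triangle$ is symmetric difference). Two hemispaces are in the same block if their symmetric difference is finite; a block is a class of this equivalence relation, with the induced order. Twisted weak order: for a Coxeter group $W'$ with root system $\Psi$ and positive roots $\Psi^+$, let $N(w)=\{\gamma\in\Psi^+\mid w^{-1}(\gamma)\in-\Psi^+\}$. A set $\Gamma\subset\Psi$ is closed if $\alpha,\beta\in\Gamma$, $k_1,k_2\in\mathbb R_{\ge0}$, $k_1\alpha+k_2\beta\in\Psi$ imply $k_1\alpha+k_2\beta\in\Gamma$; $B\subset\Psi^+$ is biclosed if $B$ and $\Psi^+\setminus B$ are closed. Then $x\le'_B y$ iff $N(x)\setminus N(y)\subset B$ and $N(y)\setminus N(x)\subset\Psi^+\setminus B$. *)

theory Defs
  imports "HOL-Analysis.Analysis" "HOL-Algebra.Group"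
begin

section \<open>Finite root systems and their affinisation\<close>

definition root_reflection :: "'v::euclidean_space \<Rightarrow> 'v \<Rightarrow> 'v" where
  "root_reflection a v = v - (2 * (v \<bullet> a) / (a \<bullet> a)) *\<^sub>R a"

text \<open>
  Root systems are reduced.  They are not required to span the ambient Euclidean space.
\<close>

definition crystallographic_root_system :: "'v::euclidean_space set \<Rightarrow> bool" where
  "crystallographic_root_system \<Phi> \<longleftrightarrow>
     finite \<Phi> \<and> 0 \<notin> \<Phi> \<and>
     (\<forall>a\<in>\<Phi>. root_reflection a ` \<Phi> = \<Phi>) \<and>
     (\<forall>a\<in>\<Phi>. \<forall>c::real. c *\<^sub>R a \<in> \<Phi> \<longleftrightarrow> c = 1 \<or> c = -1) \<and>
     (\<forall>a\<in>\<Phi>. \<forall>b\<in>\<Phi>. 2 * (b \<bullet> a) / (a \<bullet> a) \<in> \<int>)"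

definition irreducible_root_system :: "'v::euclidean_space set \<Rightarrow> bool" where
  "irreducible_root_system \<Phi> \<longleftrightarrow>
     \<Phi> \<noteq> {} \<and>
     \<not> (\<exists>X Y. X \<noteq> {} \<and> Y \<noteq> {} \<and> X \<inter> Y = {} \<and> \<Phi> = X \<union> Y \<and>
            (\<forall>a\<in>X. \<forall>b\<in>Y. a \<bullet> b = 0))"

definition positive_system :: "'v::euclidean_space set \<Rightarrow> 'v set \<Rightarrow> bool" where
  "positive_system \<Phi> P \<longleftrightarrow>
     (\<exists>v. (\<forall>a\<in>\<Phi>. v \<bullet> a \<noteq> 0) \<and> P = {a \<in> \<Phi>. v \<bullet> a > 0})"

text \<open>
  The pair \<open>(a, c)\<close> stands for the vector \<open>a + c \<delta>\<close> of \<open>V \<oplus> \<real> \<delta>\<close>.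
\<close>

definition root_hat :: "'v::euclidean_space set \<Rightarrow> 'v \<Rightarrow> ('v \<times> real) set" where
  "root_hat P a = (if a \<in> P then {(a, real n) |n. True} else {(a, real (n + 1)) |n. True})"

definition affine_positive_roots :: "'v::euclidean_space set \<Rightarrow> 'v set \<Rightarrow> ('v \<times> real) set" where
  "affine_positive_roots \<Phi> P = (\<Union>a\<in>\<Phi>. root_hat P a)"

definition affine_roots :: "'v::euclidean_space set \<Rightarrow> 'v set \<Rightarrow> ('v \<times> real) set" where
  "affine_roots \<Phi> P = affine_positive_roots \<Phi> P \<union> uminus ` affine_positive_roots \<Phi> P"


section \<open>Hemispaces, tope posets and blocks\<close>

text \<open>Below, \<open>E\<close> is the ground set (symmetric under negation) of the oriented matroid
  \<open>(E, -, cone_in E)\<close>.\<close>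

definition sum_cone :: "'w::real_vector set \<Rightarrow> 'w set" where
  "sum_cone \<Gamma> = {x. \<exists>(n::nat) k v. (\<forall>i<n. (0::real) \<le> k i \<and> v i \<in> \<Gamma> \<union> {0}) \<and>
                        x = (\<Sum>i<n. k i *\<^sub>R v i)}"

definition cone_in :: "'w::real_vector set \<Rightarrow> 'w set \<Rightarrow> 'w set" where
  "cone_in E \<Gamma> = sum_cone \<Gamma> \<inter> E"

definition matroid_convex :: "'w::real_vector set \<Rightarrow> 'w set \<Rightarrow> bool" where
  "matroid_convex E F \<longleftrightarrow> F \<subseteq> E \<and> cone_in E F = F"

definition hemispaces :: "'w::real_vector set \<Rightarrow> 'w set set" where
  "hemispaces E = {F. matroid_convex E F \<and> F \<inter> uminus ` F = {} \<and> F \<union> uminus ` F = E}"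

definition tope_le :: "'w set \<Rightarrow> 'w set \<Rightarrow> 'w set \<Rightarrow> bool" where
  "tope_le H F G \<longleftrightarrow> sym_diff F H \<subseteq> sym_diff G H"

definition block_rel :: "'w::real_vector set \<Rightarrow> ('w set \<times> 'w set) set" where
  "block_rel E = {(F, G). F \<in> hemispaces E \<and> G \<in> hemispaces E \<and> finite (sym_diff F G)}"

definition blocks :: "'w::real_vector set \<Rightarrow> 'w set set set" where
  "blocks E = hemispaces E // block_rel E"


section \<open>Coxeter groups and their root systems\<close>

text \<open>\<open>m s t = 0\<close> encodes the Coxeter matrix entry \<open>\<infinity>\<close>.\<close>

definition coxeter_matrix :: "'i set \<Rightarrow> ('i \<Rightarrow> 'i \<Rightarrow> nat) \<Rightarrow> bool" where
  "coxeter_matrix I m \<longleftrightarrow>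
     (\<forall>s\<in>I. m s s = 1) \<and>
     (\<forall>s\<in>I. \<forall>t\<in>I. m s t = m t s) \<and>
     (\<forall>s\<in>I. \<forall>t\<in>I. s \<noteq> t \<longrightarrow> m s t \<noteq> 1)"

text \<open>
  The Coxeter group with generating set \<open>I\<close> and relations \<open>(s t)\<^bsup>m s t\<^esup> = 1\<close> is realised as the
  monoid of words over \<open>I\<close> modulo these relations; as \<open>m s s = 1\<close>, every generator is its own
  inverse, so no formal inverses are needed.
\<close>

inductive coxeter_step :: "'i set \<Rightarrow> ('i \<Rightarrow> 'i \<Rightarrow> nat) \<Rightarrow> 'i list \<Rightarrow> 'i list \<Rightarrow> bool"
  for I m where
  "\<lbrakk>u \<in> lists I; v \<in> lists I; s \<in> I; t \<in> I\<rbrakk> \<Longrightarrow>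
     coxeter_step I m (u @ concat (replicate (m s t) [s, t]) @ v) (u @ v)"

definition coxeter_rel :: "'i set \<Rightarrow> ('i \<Rightarrow> 'i \<Rightarrow> nat) \<Rightarrow> ('i list \<times> 'i list) set" where
  "coxeter_rel I m = {(u, v). u \<in> lists I \<and> v \<in> lists I \<and> equivclp (coxeter_step I m) u v}"

definition coxeter_group :: "'i set \<Rightarrow> ('i \<Rightarrow> 'i \<Rightarrow> nat) \<Rightarrow> 'i list set monoid" where
  "coxeter_group I m =
     \<lparr>carrier = lists I // coxeter_rel I m,
      mult = (\<lambda>x y. \<Union>u\<in>x. \<Union>v\<in>y. coxeter_rel I m `` {u @ v}),
      one = coxeter_rel I m `` {[]}\<rparr>"

text \<open>
  The geometric representation: a finitely supported function \<open>v :: 'i \<Rightarrow> real\<close> stands for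
  \<open>\<Sum>\<^sub>s v s \<alpha>\<^sub>s\<close>, and the bilinear form is given by \<open>(\<alpha>\<^sub>s, \<alpha>\<^sub>t) = - cos (\<pi> / m s t)\<close>,
  which is \<open>-1\<close> for \<open>m s t = \<infinity>\<close>.
\<close>

definition coxeter_form :: "('i \<Rightarrow> 'i \<Rightarrow> nat) \<Rightarrow> 'i \<Rightarrow> 'i \<Rightarrow> real" where
  "coxeter_form m s t = (if m s t = 0 then -1 else - cos (pi / real (m s t)))"

definition simple_root :: "'i \<Rightarrow> 'i \<Rightarrow> real" where
  "simple_root s = (\<lambda>t. if t = s then 1 else 0)"

definition simple_refl :: "('i \<Rightarrow> 'i \<Rightarrow> nat) \<Rightarrow> 'i \<Rightarrow> ('i \<Rightarrow> real) \<Rightarrow> ('i \<Rightarrow> real)" where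
  "simple_refl m s v =
     (\<lambda>r. v r - 2 * (\<Sum>t | v t \<noteq> 0. v t * coxeter_form m s t) * simple_root s r)"

definition word_act :: "('i \<Rightarrow> 'i \<Rightarrow> nat) \<Rightarrow> 'i list \<Rightarrow> ('i \<Rightarrow> real) \<Rightarrow> ('i \<Rightarrow> real)" where
  "word_act m u = foldr (simple_refl m) u"

text \<open>On the space spanned by the simple roots of \<open>I\<close>, all words in a class \<open>w\<close> of
  \<open>coxeter_group I m\<close> act in the same way.\<close>

definition coxeter_act :: "('i \<Rightarrow> 'i \<Rightarrow> nat) \<Rightarrow> 'i list set \<Rightarrow> ('i \<Rightarrow> real) \<Rightarrow> ('i \<Rightarrow> real)" where
  "coxeter_act m w \<gamma> = the_elem ((\<lambda>u. word_act m u \<gamma>) ` w)"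

definition coxeter_roots :: "'i set \<Rightarrow> ('i \<Rightarrow> 'i \<Rightarrow> nat) \<Rightarrow> ('i \<Rightarrow> real) set" where
  "coxeter_roots I m =
     {coxeter_act m w (simple_root s) |w s. w \<in> carrier (coxeter_group I m) \<and> s \<in> I}"

definition coxeter_pos_roots :: "'i set \<Rightarrow> ('i \<Rightarrow> 'i \<Rightarrow> nat) \<Rightarrow> ('i \<Rightarrow> real) set" where
  "coxeter_pos_roots I m = {\<gamma> \<in> coxeter_roots I m. \<forall>s. 0 \<le> \<gamma> s}"

definition inversions :: "'i set \<Rightarrow> ('i \<Rightarrow> 'i \<Rightarrow> nat) \<Rightarrow> 'i list set \<Rightarrow> ('i \<Rightarrow> real) set" where
  "inversions I m w =
     {\<gamma> \<in> coxeter_pos_roots I m.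
        (\<lambda>s. - coxeter_act m (inv\<^bsub>coxeter_group I m\<^esub> w) \<gamma> s) \<in> coxeter_pos_roots I m}"

definition root_closed :: "('i \<Rightarrow> real) set \<Rightarrow> ('i \<Rightarrow> real) set \<Rightarrow> bool" where
  "root_closed \<Psi> \<Gamma> \<longleftrightarrow>
     \<Gamma> \<subseteq> \<Psi> \<and>
     (\<forall>a\<in>\<Gamma>. \<forall>b\<in>\<Gamma>. \<forall>k\<^sub>1\<ge>0. \<forall>k\<^sub>2\<ge>0.
        (\<lambda>s. k\<^sub>1 * a s + k\<^sub>2 * b s) \<in> \<Psi> \<longrightarrow> (\<lambda>s. k\<^sub>1 * a s + k\<^sub>2 * b s) \<in> \<Gamma>)"

definition root_biclosed :: "'i set \<Rightarrow> ('i \<Rightarrow> 'i \<Rightarrow> nat) \<Rightarrow> ('i \<Rightarrow> real) set \<Rightarrow> bool" where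
  "root_biclosed I m B \<longleftrightarrow>
     B \<subseteq> coxeter_pos_roots I m \<and>
     root_closed (coxeter_roots I m) B \<and>
     root_closed (coxeter_roots I m) (coxeter_pos_roots I m - B)"

definition twisted_le ::
  "'i set \<Rightarrow> ('i \<Rightarrow> 'i \<Rightarrow> nat) \<Rightarrow> ('i \<Rightarrow> real) set \<Rightarrow> 'i list set \<Rightarrow> 'i list set \<Rightarrow> bool" where
  "twisted_le I m B x y \<longleftrightarrow>
     inversions I m x - inversions I m y \<subseteq> B \<and>
     inversions I m y - inversions I m x \<subseteq> coxeter_pos_roots I m - B"

definition poset_isomorphic ::
  "'a set \<Rightarrow> ('a \<Rightarrow> 'a \<Rightarrow> bool) \<Rightarrow> 'b set \<Rightarrow> ('b \<Rightarrow> 'b \<Rightarrow> bool) \<Rightarrow> bool" where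
  "poset_isomorphic A le\<^sub>A B le\<^sub>B \<longleftrightarrow>
     (\<exists>f. bij_betw f A B \<and> (\<forall>x\<in>A. \<forall>y\<in>A. le\<^sub>A x y \<longleftrightarrow> le\<^sub>B (f x) (f y)))"

end

theory Submission
  imports Defs
begin

text \<open>
  No classification of the blocks is needed.  Let \<open>C\<close> be any hemispace of the block, with the roots
  rescaled to unit length, and let the simple roots be the elements of \<open>C\<close> spanning extreme rays of
  its cone.  The reflection in a simple root changes \<open>C\<close> only at that root, and every hemispace \<open>F\<close>
  with \<open>C - F\<close> finite and nonempty omits some simple root, so that the group \<open>W'\<close> generated by the
  simple reflections acts transitively on the block.  Words in the simple reflections are galleries
  starting at \<open>C\<close>.  A closed gallery can be contracted by pushing its peaks down across rank two
  residues, and each such move is a Coxeter relation; so \<open>W'\<close> is a Coxeter group and acts simply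
  transitively.  The same descent identifies the positive roots of its geometric representation with
  the roots of \<open>C\<close> that some element of the block omits, and \<open>N(w)\<close> with \<open>C - w C\<close>.  Under
  this identification the order based at \<open>H\<close> is \<open>\<le>'\<^sub>B\<close> for the set \<open>B\<close> of positive roots
  outside \<open>H\<close>.
\<close>

section \<open>Cones and hemispaces\<close>

text \<open>Two features of a general block shape the argument. A hemispace need not be generated by
  its simple roots: if it contains (a, n) for some a and all integers n, each of these is the
  midpoint of two others, so none of them is simple. Only the finite differences within a block can
  therefore carry an induction. Moreover the simple roots may be linearly dependent, for instance
  when two orthogonal components each have affine simple roots with \<delta> among their
  combinations. So the geometric representation of W' need not embed in V', and an identity in V'
  says nothing about it directly. What survives is the independence of any two simple roots, a
  consequence of extremality; all computations are made in rank two and propagated along galleries.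
  Unit length makes the form on two simple roots equal to -cos (pi / m), and since the system is
  crystallographic only m = 2, 3, 4, 6 and \<infinity> occur, so that short polynomial checks
  replace trigonometry.\<close>

lemma zero_in_sum_cone: "0 \<in> sum_cone \<Gamma>"
  unfolding sum_cone_def by (rule CollectI, rule exI[of _ 0]) auto

lemma sum_cone_add_scaleR:
  assumes "x \<in> sum_cone \<Gamma>" "v \<in> \<Gamma>" "0 \<le> c"
  shows "x + c *\<^sub>R v \<in> sum_cone \<Gamma>"
proof -
  obtain n :: nat and k w where kw: "\<forall>i<n. (0::real) \<le> k i \<and> w i \<in> \<Gamma> \<union> {0}"
      "x = (\<Sum>i<n. k i *\<^sub>R w i)"
    using assms(1) unfolding sum_cone_def by blast
  have "x + c *\<^sub>R v = (\<Sum>i<Suc n. (k(n := c)) i *\<^sub>R (w(n := v)) i)"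
    using kw(2) by simp
  moreover have "\<forall>i<Suc n. 0 \<le> (k(n := c)) i \<and> (w(n := v)) i \<in> \<Gamma> \<union> {0}"
    using kw(1) assms by (auto simp: less_Suc_eq)
  ultimately show ?thesis unfolding sum_cone_def by blast
qed

text \<open>Zero summands, which \<open>sum_cone\<close> admits, are skipped, so the step meets only
  elements of \<Gamma>.\<close>

lemma sum_cone_induct [consumes 1, case_names zero add]:
  assumes "x \<in> sum_cone \<Gamma>" "P 0"
    and step: "\<And>x v c. x \<in> sum_cone \<Gamma> \<Longrightarrow> P x \<Longrightarrow> v \<in> \<Gamma> \<Longrightarrow> 0 \<le> c \<Longrightarrow> P (x + c *\<^sub>R v)"
  shows "P x"
proof -
  obtain n :: nat and k w where kw: "\<forall>i<n. (0::real) \<le> k i \<and> w i \<in> \<Gamma> \<union> {0}"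
      "x = (\<Sum>i<n. k i *\<^sub>R w i)"
    using assms(1) unfolding sum_cone_def by blast
  have "j \<le> n \<Longrightarrow> (\<Sum>i<j. k i *\<^sub>R w i) \<in> sum_cone \<Gamma> \<and> P (\<Sum>i<j. k i *\<^sub>R w i)" for j
  proof (induction j)
    case 0
    then show ?case using assms(2) zero_in_sum_cone by auto
  next
    case (Suc j)
    show ?case
    proof (cases "w j = 0")
      case True
      then show ?thesis using Suc by auto
    next
      case False
      then have "w j \<in> \<Gamma>" "0 \<le> k j" using kw(1)[rule_format, of j] Suc.prems by auto
      then show ?thesis using Suc step sum_cone_add_scaleR by auto
    qed
  qed
  then show ?thesis using kw(2) by auto
qed

lemma sum_cone_base: "v \<in> \<Gamma> \<Longrightarrow> v \<in> sum_cone \<Gamma>"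
  using sum_cone_add_scaleR[OF zero_in_sum_cone, of v \<Gamma> 1] by simp

lemma sum_cone_add:
  assumes "x \<in> sum_cone \<Gamma>" "y \<in> sum_cone \<Gamma>"
  shows "x + y \<in> sum_cone \<Gamma>"
  using assms(2)
proof (induction y rule: sum_cone_induct)
  case zero
  then show ?case using assms(1) by simp
next
  case (add y v c)
  then show ?case using sum_cone_add_scaleR[of "x + y" \<Gamma> v c] by (simp add: add.assoc)
qed

lemma sum_cone_scaleR:
  assumes "x \<in> sum_cone \<Gamma>" "0 \<le> c"
  shows "c *\<^sub>R x \<in> sum_cone \<Gamma>"
  using assms(1)
proof (induction x rule: sum_cone_induct)
  case zero
  then show ?case by (simp add: zero_in_sum_cone)
next
  case (add y v k)
  then show ?case using sum_cone_add_scaleR[of "c *\<^sub>R y" \<Gamma> v "c * k"] assms(2)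
    by (simp add: scaleR_add_right)
qed

lemma sum_cone_sum:
  assumes "\<And>i. i \<in> A \<Longrightarrow> f i \<in> sum_cone \<Gamma>"
  shows "sum f A \<in> sum_cone \<Gamma>"
  using assms by (induction A rule: infinite_finite_induct) (auto simp: zero_in_sum_cone sum_cone_add)

lemma sum_cone_least:
  assumes "\<Gamma> \<subseteq> sum_cone \<Delta>"
  shows "sum_cone \<Gamma> \<subseteq> sum_cone \<Delta>"
proof
  fix x assume "x \<in> sum_cone \<Gamma>"
  then show "x \<in> sum_cone \<Delta>"
    by (induction x rule: sum_cone_induct)
      (use assms in \<open>auto simp: zero_in_sum_cone intro!: sum_cone_add sum_cone_scaleR\<close>)
qed

lemma sum_cone_mono: "\<Gamma> \<subseteq> \<Delta> \<Longrightarrow> sum_cone \<Gamma> \<subseteq> sum_cone \<Delta>"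
  by (rule sum_cone_least) (auto intro: sum_cone_base)

lemma sum_cone_linear_image:
  assumes "linear f" "x \<in> sum_cone \<Gamma>"
  shows "f x \<in> sum_cone (f ` \<Gamma>)"
  using assms(2)
  by (induction x rule: sum_cone_induct)
    (auto simp: linear_0[OF assms(1)] linear_add[OF assms(1)] linear_scale[OF assms(1)]
       zero_in_sum_cone intro!: sum_cone_add_scaleR)

lemma sum_cone_insertE:
  assumes "x \<in> sum_cone (insert v \<Gamma>)"
  obtains c u where "0 \<le> c" "u \<in> sum_cone \<Gamma>" "x = c *\<^sub>R v + u"
proof -
  from assms have "\<exists>c u. 0 \<le> c \<and> u \<in> sum_cone \<Gamma> \<and> x = c *\<^sub>R v + u"
  proof (induction x rule: sum_cone_induct)
    case zero
    then show ?case by (intro exI[of _ 0]) (auto simp: zero_in_sum_cone)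
  next
    case (add x w k)
    then obtain c u where cu: "0 \<le> c" "u \<in> sum_cone \<Gamma>" "x = c *\<^sub>R v + u" by blast
    show ?case
    proof (cases "w = v")
      case True
      then show ?thesis using cu add
        by (intro exI[of _ "c + k"] exI[of _ u]) (auto simp: scaleR_add_left)
    next
      case False
      then show ?thesis using cu add
        by (intro exI[of _ c] exI[of _ "u + k *\<^sub>R w"]) (auto intro: sum_cone_add_scaleR)
    qed
  qed
  then show ?thesis using that by blast
qed

lemma sum_cone_pairI:
  assumes "0 \<le> p" "0 \<le> q"
  shows "p *\<^sub>R a + q *\<^sub>R b \<in> sum_cone {a, b}"
  using assms by (intro sum_cone_add sum_cone_scaleR sum_cone_base) auto

section \<open>Hemispaces: one root from each opposite pair, closed under cones\<close>

lemma hemispacesD: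
  assumes "F \<in> hemispaces E"
  shows hemispace_subset: "F \<subseteq> E"
    and hemispace_cone: "x \<in> sum_cone F \<Longrightarrow> x \<in> E \<Longrightarrow> x \<in> F"
    and hemispace_uminus_ground: "x \<in> E \<Longrightarrow> - x \<in> E"
    and hemispace_uminus_iff: "x \<in> E \<Longrightarrow> - x \<in> F \<longleftrightarrow> x \<notin> F"
proof -
  have F: "F \<subseteq> E" "sum_cone F \<inter> E = F" "F \<inter> uminus ` F = {}" "F \<union> uminus ` F = E"
    using assms by (auto simp: hemispaces_def matroid_convex_def cone_in_def)
  then show "F \<subseteq> E" "x \<in> sum_cone F \<Longrightarrow> x \<in> E \<Longrightarrow> x \<in> F" by auto
  show "- x \<in> E" if "x \<in> E" using that F(4) by force
  show "- x \<in> F \<longleftrightarrow> x \<notin> F" if "x \<in> E"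
  proof
    show "x \<notin> F" if "- x \<in> F"
    proof
      assume "x \<in> F"
      then have "- x \<in> uminus ` F" by blast
      then show False using that F(3) by blast
    qed
    show "- x \<in> F" if "x \<notin> F"
    proof -
      have "x \<in> uminus ` F" using that \<open>x \<in> E\<close> F(4) by blast
      then show ?thesis by force
    qed
  qed
qed

lemma hemispacesI:
  assumes "F \<subseteq> E" "\<And>x. x \<in> sum_cone F \<Longrightarrow> x \<in> E \<Longrightarrow> x \<in> F"
    and "\<And>x. x \<in> E \<Longrightarrow> - x \<in> E" "\<And>x. x \<in> E \<Longrightarrow> - x \<in> F \<longleftrightarrow> x \<notin> F"
  shows "F \<in> hemispaces E"
proof -
  have "cone_in E F = F"
    using assms(1,2) sum_cone_base unfolding cone_in_def by blast
  moreover have "F \<inter> uminus ` F = {}" using assms(1,4) by force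
  moreover have "F \<union> uminus ` F = E"
  proof
    show "F \<union> uminus ` F \<subseteq> E" using assms(1,3) by auto
    show "E \<subseteq> F \<union> uminus ` F"
    proof
      fix x assume "x \<in> E"
      then have "x \<in> F \<or> - x \<in> F" using assms(4) by blast
      then show "x \<in> F \<union> uminus ` F" by force
    qed
  qed
  ultimately show ?thesis using assms(1) by (auto simp: hemispaces_def matroid_convex_def)
qed

lemma hemispace_linear_image:
  assumes F: "F \<in> hemispaces E" and f: "linear f" "\<And>x. f (f x) = x" "f ` E \<subseteq> E"
  shows "f ` F \<in> hemispaces E"
proof (rule hemispacesI)
  have mem: "x \<in> f ` F \<longleftrightarrow> f x \<in> F" for x
    using f(2) by (metis image_iff)
  show "f ` F \<subseteq> E" using hemispace_subset[OF F] f(3) by blast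
  show "x \<in> f ` F" if "x \<in> sum_cone (f ` F)" "x \<in> E" for x
  proof -
    have "f x \<in> sum_cone (f ` f ` F)" using sum_cone_linear_image[OF f(1)] that by blast
    moreover have "f ` f ` F = F" using f(2) by (force simp: image_image)
    ultimately show ?thesis using hemispace_cone[OF F] that(2) f(3) mem by auto
  qed
  show "- x \<in> E" if "x \<in> E" for x using hemispace_uminus_ground[OF F that] .
  show "- x \<in> f ` F \<longleftrightarrow> x \<notin> f ` F" if "x \<in> E" for x
    using hemispace_uminus_iff[OF F, of "f x"] that f(3) linear_neg[OF f(1), of x]
    unfolding mem by auto
qed

text \<open>The relation would put -x into the cone of \<open>F\<close>, hence into \<open>F\<close>
  beside x.\<close>

lemma hemispace_pointed:
  assumes F: "F \<in> hemispaces E" and "x \<in> F" "y \<in> sum_cone F" "0 < c"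
  shows "c *\<^sub>R x + y \<noteq> 0"
proof
  assume "c *\<^sub>R x + y = 0"
  then have "y = - (c *\<^sub>R x)" by (simp add: eq_neg_iff_add_eq_0 add.commute)
  then have "- x = (1 / c) *\<^sub>R y" using assms(4) by simp
  then have "- x \<in> sum_cone F" using sum_cone_scaleR[OF assms(3)] assms(4) by simp
  then show False
    using hemispace_cone[OF F] hemispace_uminus_ground[OF F] hemispace_uminus_iff[OF F]
      hemispace_subset[OF F] assms(2) by blast
qed

text \<open>Obtained without a functional positive on \<open>F\<close>, by peeling off one generator
  at a time.\<close>

lemma hemispace_salient:
  assumes F: "F \<in> hemispaces E" and "x \<in> sum_cone F" "y \<in> sum_cone F" "x + y = 0"
  shows "x = 0"
  using assms(2-)
proof (induction x arbitrary: y rule: sum_cone_induct)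
  case (add x v c)
  have "c = 0"
  proof (rule ccontr)
    assume "c \<noteq> 0"
    then have "c *\<^sub>R v + (x + y) \<noteq> 0"
      using add by (intro hemispace_pointed[OF F]) (auto intro: sum_cone_add)
    then show False using add.prems by (simp add: algebra_simps)
  qed
  then show ?case using add by auto
qed auto

lemma hemispace_eqI:
  assumes "F \<in> hemispaces E" "G \<in> hemispaces E" "F \<subseteq> G"
  shows "F = G"
  using assms hemispace_uminus_iff hemispace_subset hemispace_uminus_ground by blast

text \<open>The two one-sided differences are negatives of each other, so it is enough to watch what
  is omitted.\<close>

lemma hemispace_sym_diff_finite_iff:
  assumes F: "F \<in> hemispaces E" and G: "G \<in> hemispaces E"
  shows "finite (sym_diff F G) \<longleftrightarrow> finite (F - G)"
proof -
  have "G - F = uminus ` (F - G)"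
  proof safe
    fix x assume x: "x \<in> G" "x \<notin> F"
    then have "- x \<in> F - G"
      using hemispace_uminus_iff[OF F, of x] hemispace_uminus_iff[OF G, of x] hemispace_subset[OF G]
      by blast
    then show "x \<in> uminus ` (F - G)" by force
  next
    fix x assume x: "x \<in> F" "x \<notin> G"
    then have "x \<in> E" using hemispace_subset[OF F] by blast
    then show "- x \<in> G" using hemispace_uminus_iff[OF G] x by blast
    show "- x \<in> F \<Longrightarrow> False" using hemispace_uminus_iff[OF F] \<open>x \<in> E\<close> x by blast
  qed
  then show ?thesis by auto
qed

section \<open>Simple roots of a hemispace\<close>

text \<open>The form may be degenerate, as it is for affine roots, where \<delta> lies in its
  radical. The values in \<open>U_bonds\<close> are the possible products of two opposite Cartan
  integers.\<close>

locale unit_root_system =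
  fixes B :: "'w::real_vector \<Rightarrow> 'w \<Rightarrow> real" and U :: "'w set"
  assumes B_add: "B (x + y) z = B x z + B y z"
    and B_scaleR: "B (c *\<^sub>R x) z = c * B x z"
    and B_commute: "B x y = B y x"
    and B_unit: "u \<in> U \<Longrightarrow> B u u = 1"
    and U_refl: "u \<in> U \<Longrightarrow> v \<in> U \<Longrightarrow> v - (2 * B v u) *\<^sub>R u \<in> U"
    and U_bonds: "u \<in> U \<Longrightarrow> v \<in> U \<Longrightarrow> 4 * (B u v)\<^sup>2 \<in> {0, 1, 2, 3, 4}"
begin

lemma B_minus: "B (- x) z = - B x z"
  using B_scaleR[of "- 1" x z] by simp

lemma B_diff: "B (x - y) z = B x z - B y z"
  using B_add[of x "- y" z] by (simp add: B_minus)

lemma B_zero: "B 0 z = 0"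
  using B_scaleR[of 0 0 z] by simp

lemmas B_simps = B_add B_scaleR B_minus B_diff B_zero

definition refl :: "'w \<Rightarrow> 'w \<Rightarrow> 'w" where
  "refl u v = v - (2 * B v u) *\<^sub>R u"

lemma linear_refl: "linear (refl u)"
  by (rule linearI) (simp_all add: refl_def B_simps algebra_simps)

lemma refl_self: "u \<in> U \<Longrightarrow> refl u u = - u"
  by (simp add: refl_def B_unit scaleR_2)

lemma refl_refl: "u \<in> U \<Longrightarrow> refl u (refl u v) = v"
proof -
  assume u: "u \<in> U"
  have "B (refl u v) u = - B v u" by (simp add: refl_def B_simps B_unit[OF u])
  then have "refl u (refl u v) = refl u v - (2 * (- B v u)) *\<^sub>R u"
    by (simp only: refl_def[of u "refl u v"])
  then show ?thesis by (simp add: refl_def)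
qed

lemma refl_in_U: "u \<in> U \<Longrightarrow> v \<in> U \<Longrightarrow> refl u v \<in> U"
  by (simp add: refl_def U_refl)

lemma unit_multiple:
  assumes "u \<in> U" "v \<in> U" "v = c *\<^sub>R u"
  shows "v = u \<or> v = - u"
proof -
  have "B v v = c * B u v" unfolding assms(3) by (simp only: B_scaleR)
  also have "B u v = B v u" by (rule B_commute)
  also have "\<dots> = c * B u u" unfolding assms(3) by (simp only: B_scaleR)
  finally have "B v v = c * c * B u u" by simp
  then have "c * c = 1" using B_unit assms by simp
  then have "c = 1 \<or> c = -1" by (simp add: square_eq_1_iff)
  then show ?thesis using assms(3) by auto
qed

end

locale chamber = unit_root_system B U
  for B :: "'w::real_vector \<Rightarrow> 'w \<Rightarrow> real" and U :: "'w set" +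
  fixes C :: "'w set"
  assumes C_hemispace: "C \<in> hemispaces U"
begin

lemmas C_U = subsetD[OF hemispace_subset[OF C_hemispace]]
  and C_cone = hemispace_cone[OF C_hemispace]
  and U_uminus = hemispace_uminus_ground[OF C_hemispace]
  and C_uminus = hemispace_uminus_iff[OF C_hemispace]
  and C_pointed = hemispace_pointed[OF C_hemispace]

lemma C_nonzero: "u \<in> C \<Longrightarrow> u \<noteq> 0"
  using C_pointed[of u 0 1] zero_in_sum_cone by auto

definition simple :: "'w set" where
  "simple = {u \<in> C. u \<notin> sum_cone (C - {u})}"

lemma simple_C: "u \<in> simple \<Longrightarrow> u \<in> C"
  and simple_U: "u \<in> simple \<Longrightarrow> u \<in> U"
  using C_U by (auto simp: simple_def)

lemma simple_extreme:
  assumes "u \<in> simple" "x \<in> C" "y \<in> C" "x \<noteq> u" "y \<noteq> u" "0 \<le> p" "0 \<le> q"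
  shows "u \<noteq> p *\<^sub>R x + q *\<^sub>R y"
proof
  assume u: "u = p *\<^sub>R x + q *\<^sub>R y"
  have "p *\<^sub>R x + q *\<^sub>R y \<in> sum_cone (C - {u})"
    by (rule subsetD[OF sum_cone_mono sum_cone_pairI]) (use assms in auto)
  then show False using assms(1) u by (auto simp: simple_def)
qed

text \<open>Otherwise v and -\<open>refl u v\<close> both lie in \<open>C\<close>, and their sum is
  k u with k = 2 B(v, u). If k > 0, this contradicts extremality of u; if k \<le> 0, the reflected
  root is in the cone of u and v after all.\<close>

lemma refl_simple_C:
  assumes u: "u \<in> simple" and v: "v \<in> C" "v \<noteq> u"
  shows "refl u v \<in> C"
proof (rule ccontr)
  assume n: "refl u v \<notin> C"
  have U: "refl u v \<in> U" using refl_in_U simple_U[OF u] C_U[OF v(1)] by blast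
  have m: "- refl u v \<in> C" using n C_uminus[OF U] by blast
  define k where "k = 2 * B v u"
  have rv: "refl u v = v - k *\<^sub>R u" by (simp add: refl_def k_def)
  show False
  proof (cases "k \<le> 0")
    case True
    have "v + (- k) *\<^sub>R u \<in> sum_cone C"
      using True v simple_C[OF u] by (intro sum_cone_add_scaleR sum_cone_base) auto
    then show False using n C_cone U rv by simp
  next
    case False
    have "- refl u v \<noteq> u"
    proof
      assume "- refl u v = u"
      then have "refl u (refl u v) = refl u (- u)" by (metis minus_equation_iff)
      then have "v = u"
        using refl_refl refl_self simple_U[OF u] linear_neg[OF linear_refl, of u u] by simp
      then show False using v by blast
    qed
    moreover have "u = (1 / k) *\<^sub>R v + (1 / k) *\<^sub>R (- refl u v)"
      unfolding scaleR_add_right[symmetric] rv using False by simp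
    ultimately show False
      using simple_extreme[OF u v(1) m v(2), of "1 / k" "1 / k"] False by simp
  qed
qed

lemma refl_simple_image:
  assumes "u \<in> simple"
  shows "refl u ` C = insert (- u) (C - {u})"
proof (rule Set.set_eqI)
  fix x
  have "x \<in> refl u ` C \<longleftrightarrow> refl u x \<in> C"
    using refl_refl[OF simple_U[OF assms]] by (metis image_iff)
  also have "\<dots> \<longleftrightarrow> x \<in> insert (- u) (C - {u})"
  proof (cases "x = u \<or> x = - u")
    case True
    then show ?thesis
      using refl_self[OF simple_U[OF assms]] linear_neg[OF linear_refl, of u u]
        simple_C[OF assms] C_uminus[OF simple_U[OF assms]] by auto
  next
    case False
    have "refl u x \<noteq> u"
      using False refl_refl[OF simple_U[OF assms], of x] refl_self[OF simple_U[OF assms]] by auto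
    then show ?thesis
      using False refl_simple_C[OF assms, of x] refl_simple_C[OF assms, of "refl u x"]
        refl_refl[OF simple_U[OF assms], of x] by auto
  qed
  finally show "x \<in> refl u ` C \<longleftrightarrow> x \<in> insert (- u) (C - {u})" .
qed

text \<open>If p < 0, then either q \<le> 0 and pointedness fails, or b becomes a nonnegative
  combination of a and the given root, against extremality. This rule stands in for linear
  independence of the simple roots.\<close>

lemma simple_comb_nonneg_right:
  assumes a: "a \<in> simple" and b: "b \<in> simple" and "a \<noteq> b"
    and r: "p *\<^sub>R a + q *\<^sub>R b \<in> C"
  shows "0 \<le> p"
proof (rule ccontr)
  assume p: "\<not> 0 \<le> p"
  let ?r = "p *\<^sub>R a + q *\<^sub>R b"
  have ab: "a \<in> C" "b \<in> C" using a b simple_C by auto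
  show False
  proof (cases "0 < q")
    case False
    have "1 *\<^sub>R ?r + ((- p) *\<^sub>R a + (- q) *\<^sub>R b) \<noteq> 0"
      using r p False ab by (intro C_pointed sum_cone_add sum_cone_scaleR sum_cone_base) auto
    then show False by simp
  next
    case True
    have "?r \<noteq> b"
    proof
      assume "?r = b"
      then have "a = ((1 - q) / p) *\<^sub>R b"
        using p by (simp add: eq_vector_fraction_iff algebra_simps)
      then have "a = - b"
        using unit_multiple[of b a] simple_U a b \<open>a \<noteq> b\<close> by blast
      then show False using C_uminus[OF C_U[OF ab(2)]] ab by auto
    qed
    moreover have "b = (1 / q) *\<^sub>R ?r + (- p / q) *\<^sub>R a"
      using True by (simp add: scaleR_add_right divide_inverse mult.commute)
    moreover have "0 \<le> - p / q" using p True by (intro divide_nonneg_pos) auto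
    ultimately show False
      using simple_extreme[OF b r ab(1), of "1 / q" "- p / q"] True \<open>a \<noteq> b\<close> by simp
  qed
qed

lemma simple_comb_nonneg:
  assumes "a \<in> simple" "b \<in> simple" "a \<noteq> b" "p *\<^sub>R a + q *\<^sub>R b \<in> C"
  shows "0 \<le> p" "0 \<le> q"
  using simple_comb_nonneg_right[of a b p q] simple_comb_nonneg_right[of b a q p] assms
  by (auto simp: add.commute)

lemma simple_obtuse:
  assumes "a \<in> simple" "b \<in> simple" "a \<noteq> b"
  shows "B a b \<le> 0"
proof -
  have "(- 2 * B b a) *\<^sub>R a + 1 *\<^sub>R b \<in> C"
    using refl_simple_C[of a b] assms simple_C by (auto simp: refl_def)
  from simple_comb_nonneg(1)[OF assms this] show ?thesis by (simp add: B_commute)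
qed

text \<open>A set \<open>D'\<close> of elements of \<open>C - F\<close> that is minimal subject to generating \<open>C\<close> together with
  \<open>C \<inter> F\<close> consists of simple roots.\<close>

lemma simple_in_difference:
  assumes F: "F \<in> hemispaces U" and fin: "finite (C - F)" and ne: "C \<noteq> F"
  obtains u where "u \<in> simple" "u \<notin> F"
proof -
  let ?D = "C - F"
  let ?ok = "\<lambda>D'. D' \<subseteq> ?D \<and> C \<subseteq> sum_cone ((C \<inter> F) \<union> D')"
  have "?ok ?D" using sum_cone_base[of _ "(C \<inter> F) \<union> ?D"] by blast
  from ex_has_least_nat[of ?ok, OF this, of card] obtain D' where
    D': "?ok D'" and least: "\<And>T. ?ok T \<Longrightarrow> card D' \<le> card T" by blast
  have "D' \<noteq> {}"
  proof
    assume "D' = {}"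
    then have "C \<subseteq> sum_cone F" using D' sum_cone_mono[of "C \<inter> F" F] by auto
    then have "C \<subseteq> F" using hemispace_cone[OF F] C_U by blast
    then show False using hemispace_eqI[OF C_hemispace F] ne by blast
  qed
  then obtain u where u: "u \<in> D'" by blast
  define T where "T = (C \<inter> F) \<union> (D' - {u})"
  have uC: "u \<in> C" "u \<notin> F" using u D' by auto
  have ins: "(C \<inter> F) \<union> D' = insert u T" using u by (auto simp: T_def)
  have TC: "T \<subseteq> C - {u}" using D' uC by (auto simp: T_def)
  have uT: "u \<notin> sum_cone T"
  proof
    assume "u \<in> sum_cone T"
    then have "(C \<inter> F) \<union> D' \<subseteq> sum_cone T" unfolding ins using sum_cone_base by auto
    then have "C \<subseteq> sum_cone T" using D' sum_cone_least by blast
    then have "card D' \<le> card (D' - {u})" using D' least[of "D' - {u}"] by (auto simp: T_def)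
    moreover have "finite D'" using D' fin finite_subset by blast
    ultimately show False using u card_Diff1_less[of D' u] by simp
  qed
  \<comment> \<open>The last conjunct says that the cone of \<open>C - {u}\<close> meets the line of
    u only in 0: no other root of \<open>C\<close> is a multiple of u, and the components in the
    salient cone of \<open>T\<close> cannot cancel.\<close>
  have decomp: "\<exists>c w. 0 \<le> c \<and> w \<in> sum_cone T \<and> x = c *\<^sub>R u + w \<and> (w = 0 \<longrightarrow> x = 0)"
    if "x \<in> sum_cone (C - {u})" for x
    using that
  proof (induction x rule: sum_cone_induct)
    case zero
    show ?case by (intro exI[of _ 0]) (auto simp: zero_in_sum_cone)
  next
    case (add x v k)
    then obtain c w where cw: "0 \<le> c" "w \<in> sum_cone T" "x = c *\<^sub>R u + w" "w = 0 \<longrightarrow> x = 0"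
      by blast
    have "v \<in> sum_cone (insert u T)" using D' add unfolding ins by blast
    then obtain c' w' where cw': "0 \<le> c'" "w' \<in> sum_cone T" "v = c' *\<^sub>R u + w'"
      by (rule sum_cone_insertE)
    have "w' \<noteq> 0"
    proof
      assume "w' = 0"
      then have "v = u \<or> v = - u" using unit_multiple[of u v c'] C_U uC cw' add by auto
      then show False using add uC C_uminus[of u] C_U by auto
    qed
    moreover have "w = 0 \<and> k *\<^sub>R w' = 0" if "w + k *\<^sub>R w' = 0"
    proof -
      have "w \<in> sum_cone C" "k *\<^sub>R w' \<in> sum_cone C"
        using sum_cone_mono[of T C] TC cw cw' sum_cone_scaleR add by blast+
      then show ?thesis using hemispace_salient[OF C_hemispace] that
        by (metis add.commute)
    qed
    ultimately have "w + k *\<^sub>R w' = 0 \<longrightarrow> x + k *\<^sub>R v = 0" using cw by auto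
    then show ?case
      using cw cw' add
      by (intro exI[of _ "c + k * c'"] exI[of _ "w + k *\<^sub>R w'"])
        (auto simp: algebra_simps intro!: sum_cone_add sum_cone_scaleR)
  qed
  have "u \<notin> sum_cone (C - {u})"
  proof
    assume "u \<in> sum_cone (C - {u})"
    then obtain c w where cw: "0 \<le> c" "w \<in> sum_cone T" "u = c *\<^sub>R u + w" "w \<noteq> 0"
      using decomp[of u] C_nonzero[OF uC(1)] by blast
    have w: "w = (1 - c) *\<^sub>R u" using cw(3) by (simp add: algebra_simps)
    \<comment> \<open>The cases contradict, in turn, the minimality of \<open>D'\<close>, the
      condition w \<noteq> 0, and pointedness.\<close>
    consider "c < 1" | "c = 1" | "c > 1" by linarith
    then show False
    proof cases
      case 1
      then have "u = (1 / (1 - c)) *\<^sub>R w" using w by simp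
      then show False using sum_cone_scaleR[OF cw(2), of "1 / (1 - c)"] 1 uT by simp
    next
      case 2
      then show False using w cw by simp
    next
      case 3
      have "w \<in> sum_cone C" using sum_cone_mono[of T C] TC cw by blast
      then have "(c - 1) *\<^sub>R u + w \<noteq> 0" using C_pointed[OF uC(1)] 3 by simp
      then show False using w by (simp add: algebra_simps)
    qed
  qed
  then show ?thesis using that uC by (auto simp: simple_def)
qed

end

section \<open>Words modulo the Coxeter relations\<close>

abbreviation rot :: "nat \<Rightarrow> 'i \<Rightarrow> 'i \<Rightarrow> 'i list" where
  "rot k s t \<equiv> concat (replicate k [s, t])"

lemma rot_Suc_right: "rot (Suc k) s t = rot k s t @ [s, t]"
  by (induction k) auto

lemma rot_add: "rot (j + k) s t = rot j s t @ rot k s t"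
  by (simp add: replicate_add)

lemma rot_in_lists: "s \<in> I \<Longrightarrow> t \<in> I \<Longrightarrow> rot k s t \<in> lists I"
  by (induction k) auto

lemma length_rot: "length (rot k s t) = 2 * k"
  by (induction k) auto

lemma Cons_rot_snoc: "s # rot k t s @ [t] = rot (Suc k) s t"
  by (induction k) auto

text \<open>Prefixes of a word running around a rank two residue mark the chambers it visits; those
  of even and of odd length need different arguments later.\<close>

lemma rot_prefix:
  assumes "x @ y = rot n t s"
  shows "\<exists>j. x = rot j t s \<and> j \<le> n \<or> x = rot j t s @ [t] \<and> j < n"
  using assms
proof (induction n arbitrary: x)
  case (Suc n)
  show ?case
  proof (cases x)
    case Nil
    then show ?thesis by (intro exI[of _ 0]) auto
  next
    case (Cons a x')
    show ?thesis
    proof (cases x')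
      case Nil
      then show ?thesis using Suc.prems Cons by (intro exI[of _ 0]) auto
    next
      case (Cons b x'')
      then have x: "x = [t, s] @ x''" "x'' @ y = rot n t s"
        using Suc.prems \<open>x = a # x'\<close> by auto
      from Suc.IH[OF x(2)] obtain j where
        "x'' = rot j t s \<and> j \<le> n \<or> x'' = rot j t s @ [t] \<and> j < n" by blast
      then show ?thesis using x(1) by (intro exI[of _ "Suc j"]) auto
    qed
  qed
qed auto

lemma coxeter_step_lists: "coxeter_step I m u v \<Longrightarrow> u \<in> lists I \<and> v \<in> lists I"
  by (induction rule: coxeter_step.induct) (auto simp: rot_in_lists)

lemma coxeter_rel_lists: "(u, v) \<in> coxeter_rel I m \<Longrightarrow> u \<in> lists I \<and> v \<in> lists I"
  by (simp add: coxeter_rel_def)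

lemma coxeter_rel_refl: "u \<in> lists I \<Longrightarrow> (u, u) \<in> coxeter_rel I m"
  by (simp add: coxeter_rel_def)

lemma coxeter_rel_sym: "(u, v) \<in> coxeter_rel I m \<Longrightarrow> (v, u) \<in> coxeter_rel I m"
  by (auto simp: coxeter_rel_def intro: equivclp_sym)

lemma coxeter_rel_trans:
  "(u, v) \<in> coxeter_rel I m \<Longrightarrow> (v, w) \<in> coxeter_rel I m \<Longrightarrow> (u, w) \<in> coxeter_rel I m"
  by (auto simp: coxeter_rel_def intro: equivclp_trans)

lemma equiv_coxeter_rel: "equiv (lists I) (coxeter_rel I m)"
  by (rule equivI)
    (auto simp: refl_on_def coxeter_rel_refl dest: coxeter_rel_lists
      intro!: symI transI intro: coxeter_rel_sym coxeter_rel_trans)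

lemma coxeter_rel_relation:
  assumes "s \<in> I" "t \<in> I"
  shows "(rot (m s t) s t, []) \<in> coxeter_rel I m"
proof -
  have "coxeter_step I m ([] @ rot (m s t) s t @ []) ([] @ [])"
    by (rule coxeter_step.intros) (use assms in auto)
  then show ?thesis
    using coxeter_step_lists by (fastforce simp: coxeter_rel_def intro: r_into_equivclp)
qed

lemma coxeter_rel_induct [consumes 1, case_names refl step]:
  assumes "(u, v) \<in> coxeter_rel I m" "P u"
    and step: "\<And>x y. coxeter_step I m x y \<Longrightarrow> P x \<longleftrightarrow> P y"
  shows "P v"
proof -
  have "equivclp (coxeter_step I m) u v" using assms(1) by (simp add: coxeter_rel_def)
  then show ?thesis using assms(2) by (induction rule: equivclp_induct) (use step in blast)+
qed

lemma coxeter_rel_context: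
  assumes "(u, v) \<in> coxeter_rel I m" "x \<in> lists I" "y \<in> lists I"
  shows "(x @ u @ y, x @ v @ y) \<in> coxeter_rel I m"
  using assms(1)
proof (induction rule: coxeter_rel_induct)
  case refl
  show ?case using coxeter_rel_lists[OF assms(1)] assms by (intro coxeter_rel_refl) auto
next
  case (step a b)
  have "coxeter_step I m (x @ a @ y) (x @ b @ y)"
    using step
  proof (cases rule: coxeter_step.cases)
    case (1 u' v' s t)
    then show ?thesis
      using coxeter_step.intros[of "x @ u'" I "v' @ y" s t m] assms by simp
  qed
  then have "(x @ a @ y, x @ b @ y) \<in> coxeter_rel I m"
    using coxeter_step_lists by (fastforce simp: coxeter_rel_def intro: r_into_equivclp)
  then show ?case using coxeter_rel_trans coxeter_rel_sym by blast
qed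

lemma coxeter_rel_append:
  assumes "(u, u') \<in> coxeter_rel I m" "(v, v') \<in> coxeter_rel I m"
  shows "(u @ v, u' @ v') \<in> coxeter_rel I m"
  using coxeter_rel_context[OF assms(1), of "[]" v] coxeter_rel_context[OF assms(2), of u' "[]"]
    coxeter_rel_lists[OF assms(1)] coxeter_rel_lists[OF assms(2)] coxeter_rel_trans
  by (metis append_Nil append_Nil2 lists.Nil)

lemma coxeter_rel_square:
  assumes "coxeter_matrix I m" "s \<in> I"
  shows "([s, s], []) \<in> coxeter_rel I m"
  using coxeter_rel_relation[of s I s m] assms by (simp add: coxeter_matrix_def)

lemma coxeter_rel_rev:
  assumes "coxeter_matrix I m" "u \<in> lists I"
  shows "(u @ rev u, []) \<in> coxeter_rel I m"
  using assms(2)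
proof (induction u)
  case Nil
  then show ?case by (simp add: coxeter_rel_refl)
next
  case (Cons s u)
  then have "([s] @ (u @ rev u) @ [s], [s] @ [] @ [s]) \<in> coxeter_rel I m"
    by (intro coxeter_rel_context) auto
  then show ?case
    using coxeter_rel_square[OF assms(1), of s] Cons coxeter_rel_trans by fastforce
qed

text \<open>As ts is inverse to st, the relation (ts)^m = 1 gives st = (ts)^(m - 1): the two ways
  around a 2m-gon, of 2 and of 2m - 2 edges.\<close>

lemma coxeter_rel_rot_flip:
  assumes M: "coxeter_matrix I m" and st: "s \<in> I" "t \<in> I" and "m s t \<noteq> 0"
  shows "([s, t], rot (m s t - 1) t s) \<in> coxeter_rel I m"
proof -
  let ?r = "rot (m s t - 1) t s"
  have "m t s = Suc (m s t - 1)" using M st \<open>m s t \<noteq> 0\<close> by (simp add: coxeter_matrix_def)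
  then have "rot (m t s) t s = ?r @ [t, s]" by (simp only: rot_Suc_right)
  then have "(?r @ [t, s] @ [s, t], [] @ [s, t]) \<in> coxeter_rel I m"
    using coxeter_rel_append[OF coxeter_rel_relation[of t I s m] coxeter_rel_refl[of "[s, t]"]] st
    by simp
  moreover have "(?r @ [t, s] @ [s, t], ?r) \<in> coxeter_rel I m"
    using coxeter_rel_append[OF coxeter_rel_refl[of ?r] coxeter_rel_rev[OF M, of "[t, s]"]] st
    by (simp add: rot_in_lists)
  ultimately show ?thesis using coxeter_rel_trans coxeter_rel_sym by (metis append_Nil)
qed

section \<open>The group structure on classes of words\<close>

abbreviation coxeter_class :: "'i set \<Rightarrow> ('i \<Rightarrow> 'i \<Rightarrow> nat) \<Rightarrow> 'i list \<Rightarrow> 'i list set" where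
  "coxeter_class I m u \<equiv> coxeter_rel I m `` {u}"

lemma carrier_coxeter_group: "carrier (coxeter_group I m) = coxeter_class I m ` lists I"
  by (auto simp: coxeter_group_def quotient_def)

lemma coxeter_class_eq_iff:
  "u \<in> lists I \<Longrightarrow> v \<in> lists I \<Longrightarrow>
    coxeter_class I m u = coxeter_class I m v \<longleftrightarrow> (u, v) \<in> coxeter_rel I m"
  using eq_equiv_class_iff[OF equiv_coxeter_rel] .

lemma coxeter_class_mult:
  assumes "u \<in> lists I" "v \<in> lists I"
  shows "coxeter_class I m u \<otimes>\<^bsub>coxeter_group I m\<^esub> coxeter_class I m v = coxeter_class I m (u @ v)"
proof -
  have "coxeter_class I m (u' @ v') = coxeter_class I m (u @ v)"
    if "(u, u') \<in> coxeter_rel I m" "(v, v') \<in> coxeter_rel I m" for u' v'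
    using coxeter_rel_append[OF that] by (metis equiv_class_eq[OF equiv_coxeter_rel])
  then have "(\<Union>u'\<in>coxeter_class I m u. \<Union>v'\<in>coxeter_class I m v. coxeter_class I m (u' @ v'))
      = (\<Union>u'\<in>coxeter_class I m u. \<Union>v'\<in>coxeter_class I m v. coxeter_class I m (u @ v))"
    by (intro SUP_cong refl) auto
  also have "\<dots> = coxeter_class I m (u @ v)"
    using coxeter_rel_refl[OF assms(1)] coxeter_rel_refl[OF assms(2)] by blast
  finally show ?thesis by (simp add: coxeter_group_def)
qed

lemma coxeter_class_one: "\<one>\<^bsub>coxeter_group I m\<^esub> = coxeter_class I m []"
  by (simp add: coxeter_group_def)

lemma coxeter_group_carrierE:
  assumes "x \<in> carrier (coxeter_group I m)"
  obtains u where "u \<in> lists I" "x = coxeter_class I m u"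
proof -
  from assms have "x \<in> coxeter_class I m ` lists I" by (simp only: carrier_coxeter_group)
  then show ?thesis by (rule imageE) (rule that)
qed

lemma coxeter_class_carrier:
  "u \<in> lists I \<Longrightarrow> coxeter_class I m u \<in> carrier (coxeter_group I m)"
  unfolding carrier_coxeter_group by (rule imageI)

lemma coxeter_class_inverse:
  assumes M: "coxeter_matrix I m" and u: "u \<in> lists I"
  shows "coxeter_class I m (rev u) \<otimes>\<^bsub>coxeter_group I m\<^esub> coxeter_class I m u = \<one>\<^bsub>coxeter_group I m\<^esub>"
proof -
  have r: "rev u \<in> lists I" using u by auto
  have "(rev u @ rev (rev u), []) \<in> coxeter_rel I m" by (rule coxeter_rel_rev[OF M r])
  then have "coxeter_class I m (rev u @ u) = coxeter_class I m []"
    using equiv_class_eq[OF equiv_coxeter_rel] by simp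
  then show ?thesis by (simp only: coxeter_class_mult[OF r u] coxeter_class_one)
qed

lemma group_coxeter_group:
  assumes M: "coxeter_matrix I m"
  shows "group (coxeter_group I m)"
proof (rule groupI)
  let ?G = "coxeter_group I m"
  show "x \<otimes>\<^bsub>?G\<^esub> y \<in> carrier ?G" if mem: "x \<in> carrier ?G" "y \<in> carrier ?G" for x y
  proof -
    obtain u where u: "u \<in> lists I" "x = coxeter_class I m u"
      using mem(1) by (rule coxeter_group_carrierE)
    obtain v where v: "v \<in> lists I" "y = coxeter_class I m v"
      using mem(2) by (rule coxeter_group_carrierE)
    have "u @ v \<in> lists I" using u v by auto
    then show ?thesis
      unfolding u(2) v(2) coxeter_class_mult[OF u(1) v(1)] by (rule coxeter_class_carrier)
  qed
  show "\<one>\<^bsub>?G\<^esub> \<in> carrier ?G"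
    unfolding coxeter_class_one by (rule coxeter_class_carrier) simp
  show "x \<otimes>\<^bsub>?G\<^esub> y \<otimes>\<^bsub>?G\<^esub> z = x \<otimes>\<^bsub>?G\<^esub> (y \<otimes>\<^bsub>?G\<^esub> z)"
    if mem: "x \<in> carrier ?G" "y \<in> carrier ?G" "z \<in> carrier ?G" for x y z
  proof -
    obtain u where u: "u \<in> lists I" "x = coxeter_class I m u"
      using mem(1) by (rule coxeter_group_carrierE)
    obtain v where v: "v \<in> lists I" "y = coxeter_class I m v"
      using mem(2) by (rule coxeter_group_carrierE)
    obtain w where w: "w \<in> lists I" "z = coxeter_class I m w"
      using mem(3) by (rule coxeter_group_carrierE)
    have "u @ v \<in> lists I" "v @ w \<in> lists I" using u v w by auto
    then show ?thesis
      unfolding u(2) v(2) w(2) using u(1) v(1) w(1) by (simp only: coxeter_class_mult append_assoc)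
  qed
  show "\<one>\<^bsub>?G\<^esub> \<otimes>\<^bsub>?G\<^esub> x = x" if mem: "x \<in> carrier ?G" for x
  proof -
    obtain u where u: "u \<in> lists I" "x = coxeter_class I m u"
      using mem by (rule coxeter_group_carrierE)
    show ?thesis
      unfolding u(2) coxeter_class_one coxeter_class_mult[OF lists.Nil u(1)] by simp
  qed
  show "\<exists>y\<in>carrier ?G. y \<otimes>\<^bsub>?G\<^esub> x = \<one>\<^bsub>?G\<^esub>" if mem: "x \<in> carrier ?G" for x
  proof -
    obtain u where u: "u \<in> lists I" "x = coxeter_class I m u"
      using mem by (rule coxeter_group_carrierE)
    have "rev u \<in> lists I" using u(1) by auto
    then have "coxeter_class I m (rev u) \<in> carrier ?G" by (rule coxeter_class_carrier)
    then show ?thesis unfolding u(2) using coxeter_class_inverse[OF M u(1)] by (rule bexI[rotated])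
  qed
qed

lemma inv_coxeter_class:
  assumes M: "coxeter_matrix I m" and u: "u \<in> lists I"
  shows "inv\<^bsub>coxeter_group I m\<^esub> (coxeter_class I m u) = coxeter_class I m (rev u)"
proof (rule group.inv_equality[OF group_coxeter_group[OF M] coxeter_class_inverse[OF M u]])
  have "rev u \<in> lists I" using u by auto
  then show "coxeter_class I m (rev u) \<in> carrier (coxeter_group I m)" by (rule coxeter_class_carrier)
qed (rule coxeter_class_carrier[OF u])

section \<open>Rotations in rank two\<close>

text \<open>\<open>dih c x y\<close> describes the effect on \<open>(p, q)\<close> of applying the reflections in \<open>b\<close> and then in
  \<open>a\<close> to \<open>v + p a + q b\<close>, for unit vectors \<open>a\<close>, \<open>b\<close> with \<open>c = (a, b)\<close>, \<open>x = (v, a)\<close>,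
  \<open>y = (v, b)\<close>.\<close>

definition dih :: "real \<Rightarrow> real \<Rightarrow> real \<Rightarrow> real \<times> real \<Rightarrow> real \<times> real" where
  "dih c x y = (\<lambda>(p, q). let q' = - q - 2 * y - 2 * c * p in (- p - 2 * x - 2 * c * q', q'))"

text \<open>For c = -cos (pi / m) the values 0, 1, 2, 3 of 4c^2 belong to m = 2, 3, 4, 6. The
  remaining value 4, at c = -1, falls to the default 0, the code for \<infinity>.\<close>

definition bond :: "real \<Rightarrow> nat" where
  "bond c = (if c = 0 then 2 else if 4 * c\<^sup>2 = 1 then 3 else if 4 * c\<^sup>2 = 2 then 4
             else if 4 * c\<^sup>2 = 3 then 6 else 0)"

lemma bond_neq_1: "bond c \<noteq> 1"
  by (simp add: bond_def)

text \<open>The computations with \<open>dih\<close> are polynomial in c, so for m = 4 and 6 it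
  suffices to record the square.\<close>

lemma bond_cases:
  assumes "c \<le> 0" "4 * c\<^sup>2 \<in> {0, 1, 2, 3, 4}"
  obtains "bond c = 2" "c = 0" | "bond c = 3" "c = - 1 / 2" | "bond c = 4" "2 * (c * c) = 1"
    | "bond c = 6" "4 * (c * c) = 3" | "bond c = 0" "c = - 1"
proof -
  have sq: "c = - d" if "c * c = d * d" "0 \<le> d" for d :: real
  proof -
    have "\<bar>c\<bar> = \<bar>d\<bar>" using that(1) by (simp add: abs_eq_iff square_eq_iff)
    then show ?thesis using assms(1) that(2) by simp
  qed
  consider "c = 0" | "4 * c\<^sup>2 = 1" | "4 * c\<^sup>2 = 2" | "4 * c\<^sup>2 = 3" | "4 * c\<^sup>2 = 4"
    using assms(2) by force
  then show ?thesis
  proof cases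
    case 2
    then have "bond c = 3" by (auto simp: bond_def)
    moreover have "c = - (1 / 2)" by (rule sq) (use 2 in \<open>simp_all add: power2_eq_square\<close>)
    ultimately show ?thesis using that(2) by simp
  next
    case 5
    then have "bond c = 0" by (auto simp: bond_def)
    moreover have "c = - 1" by (rule sq) (use 5 in \<open>simp_all add: power2_eq_square\<close>)
    ultimately show ?thesis using that(5) by simp
  next
    case 3
    then have "bond c = 4" by (auto simp: bond_def)
    then show ?thesis using that(3) 3 by (simp add: power2_eq_square)
  next
    case 4
    then have "bond c = 6" by (auto simp: bond_def)
    then show ?thesis using that(4) 4 by (simp add: power2_eq_square)
  qed (use that(1) in \<open>auto simp: bond_def\<close>)
qed

lemma bond_form:
  assumes "c \<le> 0" "4 * c\<^sup>2 \<in> {0, 1, 2, 3, 4}"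
  shows "(if bond c = 0 then - 1 else - cos (pi / real (bond c))) = c"
proof -
  have sq: "- d = c" if "c * c = d * d" "0 \<le> d" for d :: real
  proof -
    have "\<bar>c\<bar> = \<bar>d\<bar>" using that(1) by (simp add: abs_eq_iff square_eq_iff)
    then show ?thesis using assms(1) that(2) by simp
  qed
  show ?thesis
    using assms
  proof (cases rule: bond_cases)
    case 3
    then show ?thesis using sq[of "cos (pi / 4)"] by (simp add: cos_45)
  next
    case 4
    then show ?thesis using sq[of "cos (pi / 6)"] by (simp add: cos_30)
  qed (auto simp: cos_60)
qed

text \<open>For m = 4 two rotation steps are the point reflection of the coordinate plane at (2(cy -
  x), 2(cx - y)), hence an involution.\<close>

lemma dih_half_turn_4:
  assumes "2 * (c * c) = 1"
  shows "(dih c x y ^^ 2) (p, q) = (4 * (c * y - x) - p, 4 * (c * x - y) - q)"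
proof -
  have cc: "c * c = 1 / 2" using assms by simp
  then have ccz: "c * (c * z) = 1 / 2 * z" for z by (metis mult.assoc)
  show ?thesis by (simp add: numeral_2_eq_2 dih_def Let_def algebra_simps cc ccz)
qed

lemma dih_half_turn_6:
  assumes "4 * (c * c) = 3"
  shows "(dih c x y ^^ 3) (p, q) = (8 * (c * y - x) - p, 8 * (c * x - y) - q)"
proof -
  have cc: "c * c = 3 / 4" using assms by simp
  then have ccz: "c * (c * z) = 3 / 4 * z" for z by (metis mult.assoc)
  show ?thesis by (simp add: numeral_3_eq_3 dih_def Let_def algebra_simps cc ccz)
qed

lemma dih_bond:
  assumes "c \<le> 0" "4 * c\<^sup>2 \<in> {0, 1, 2, 3, 4}"
  shows "(dih c x y ^^ bond c) (p, q) = (p, q)"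
  using assms
proof (cases rule: bond_cases)
  case 3
  have "(dih c x y ^^ (2 + 2)) (p, q) = (p, q)"
    unfolding funpow_add comp_apply dih_half_turn_4[OF 3(2)] by simp
  then show ?thesis using 3 by simp
next
  case 4
  have "(dih c x y ^^ (3 + 3)) (p, q) = (p, q)"
    unfolding funpow_add comp_apply dih_half_turn_6[OF 4(2)] by simp
  then show ?thesis using 4 by simp
qed (simp_all add: dih_def Let_def numeral_2_eq_2 numeral_3_eq_3)

text \<open>For v = b the parameters x, y are c and 1, and p, 1 + q are the coordinates of b after j
  rotations. Up to and including the half turn, b is sent to a negative combination of a and
  b.\<close>

lemma dih_negative:
  assumes c: "c \<le> 0" "4 * c\<^sup>2 \<in> {0, 1, 2, 3, 4}" and j: "0 < j" "2 * j \<le> bond c"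
    and pq: "(dih c c 1 ^^ j) (0, 0) = (p, q)"
  shows "p \<le> 0" "1 + q \<le> 0"
proof -
  have 1: "p \<le> 0 \<and> 1 + q \<le> 0" if "j = 1"
    using pq c that by (auto simp: dih_def Let_def)
  have "p \<le> 0 \<and> 1 + q \<le> 0"
    using c
  proof (cases rule: bond_cases)
    case 3
    then consider "j = 1" | "j = 2" using j by linarith
    then show ?thesis using 1 pq dih_half_turn_4[OF 3(2), of c 1 0 0] 3(2) by cases auto
  next
    case 4
    then consider "j = 1" | "j = 2" | "j = 3" using j by linarith
    then show ?thesis
    proof cases
      case 2
      \<comment> \<open>Two steps for m = 6 are neither a single rotation nor a half turn and are
        computed directly.\<close>
      have "p = 2 * c" "q = - 3"
        using pq 4(2) unfolding 2 by (simp_all add: numeral_2_eq_2 dih_def Let_def)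
      then show ?thesis using c by simp
    qed (use 1 pq dih_half_turn_6[OF 4(2), of c 1 0 0] 4(2) in auto)
  qed (use 1 j in auto)
  then show "p \<le> 0" "1 + q \<le> 0" by auto
qed

section \<open>The group generated by the simple reflections\<close>

text \<open>Simple roots are named by indices since the letters of the Coxeter group have a type of
  their own; the theorem asks for natural numbers.\<close>

locale simple_system = chamber B U C
  for B :: "'w::real_vector \<Rightarrow> 'w \<Rightarrow> real" and U C :: "'w set" +
  fixes I :: "'i set" and \<alpha> :: "'i \<Rightarrow> 'w"
  assumes bij_simple: "bij_betw \<alpha> I simple"
begin

lemma alpha_simple: "s \<in> I \<Longrightarrow> \<alpha> s \<in> simple"
  using bij_simple by (auto simp: bij_betw_def)

lemma simple_alphaE:
  assumes "a \<in> simple"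
  obtains s where "s \<in> I" "a = \<alpha> s"
  using bij_betw_imp_surj_on[OF bij_simple] assms by blast

lemma alpha_C: "s \<in> I \<Longrightarrow> \<alpha> s \<in> C"
  and alpha_U: "s \<in> I \<Longrightarrow> \<alpha> s \<in> U"
  using alpha_simple simple_C simple_U by blast+

lemma alpha_eq_iff: "s \<in> I \<Longrightarrow> t \<in> I \<Longrightarrow> \<alpha> s = \<alpha> t \<longleftrightarrow> s = t"
  using bij_simple by (auto simp: bij_betw_def inj_on_def)

text \<open>The diagonal is set apart because \<open>bond 1\<close> is 0.\<close>

definition cox_mat :: "'i \<Rightarrow> 'i \<Rightarrow> nat" where
  "cox_mat s t = (if s = t then 1 else bond (B (\<alpha> s) (\<alpha> t)))"

lemma coxeter_matrix_cox_mat: "coxeter_matrix I cox_mat"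
  using bond_neq_1 by (auto simp: coxeter_matrix_def cox_mat_def B_commute)

lemma B_alpha_cases:
  assumes "s \<in> I" "t \<in> I" "s \<noteq> t"
  shows "B (\<alpha> s) (\<alpha> t) \<le> 0" "4 * (B (\<alpha> s) (\<alpha> t))\<^sup>2 \<in> {0, 1, 2, 3, 4}"
  using assms simple_obtuse[OF alpha_simple alpha_simple] alpha_eq_iff
    U_bonds[OF alpha_U alpha_U] by blast+

lemma coxeter_form_cox_mat:
  assumes "s \<in> I" "t \<in> I"
  shows "coxeter_form cox_mat s t = B (\<alpha> s) (\<alpha> t)"
proof (cases "s = t")
  case True
  then show ?thesis using B_unit alpha_U assms by (simp add: coxeter_form_def cox_mat_def)
next
  case False
  then show ?thesis using bond_form[OF B_alpha_cases[OF assms False]]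
    by (auto simp: coxeter_form_def cox_mat_def split: if_splits)
qed

definition act :: "'i list \<Rightarrow> 'w \<Rightarrow> 'w" where
  "act u = foldr (\<lambda>s. refl (\<alpha> s)) u"

lemma act_Nil [simp]: "act [] v = v"
  and act_Cons [simp]: "act (s # u) v = refl (\<alpha> s) (act u v)"
  and act_append [simp]: "act (u @ w) v = act u (act w v)"
  by (simp_all add: act_def)

lemma linear_act: "linear (act u)"
proof (induction u)
  case Nil
  then show ?case by (intro linearI) simp_all
next
  case (Cons s u)
  then show ?case using linear_compose[OF Cons linear_refl, of "\<alpha> s"] by (simp add: comp_def)
qed

lemmas act_minus = linear_neg[OF linear_act]
  and act_add = linear_add[OF linear_act]
  and act_scaleR = linear_scale[OF linear_act]

lemma act_U: "u \<in> lists I \<Longrightarrow> v \<in> U \<Longrightarrow> act u v \<in> U"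
  by (induction u) (auto simp: refl_in_U alpha_U)

lemma act_rev_act: "u \<in> lists I \<Longrightarrow> act (rev u) (act u v) = v"
  by (induction u arbitrary: v) (auto simp: refl_refl alpha_U)

lemma act_act_rev: "u \<in> lists I \<Longrightarrow> act u (act (rev u) v) = v"
  using act_rev_act[of "rev u" v] by (simp add: in_lists_conv_set)

lemma mem_act_image:
  assumes "u \<in> lists I"
  shows "v \<in> act u ` S \<longleftrightarrow> act (rev u) v \<in> S"
proof
  show "act (rev u) v \<in> S" if "v \<in> act u ` S"
    using that act_rev_act[OF assms] by auto
  show "v \<in> act u ` S" if "act (rev u) v \<in> S"
    using imageI[OF that, of "act u"] by (simp add: act_act_rev[OF assms])
qed

lemma act_append_image: "act (u @ w) ` S = act u ` act w ` S"
  by (simp add: image_image)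

lemma act_C_hemispace: "u \<in> lists I \<Longrightarrow> act u ` C \<in> hemispaces U"
proof (induction u)
  case Nil
  then show ?case by (simp add: C_hemispace)
next
  case (Cons s u)
  then have "act u ` C \<in> hemispaces U" "\<alpha> s \<in> U" using alpha_U by auto
  then have "refl (\<alpha> s) ` act u ` C \<in> hemispaces U"
    by (intro hemispace_linear_image[OF _ linear_refl refl_refl]) (auto simp: refl_in_U)
  then show ?case by (simp add: image_image)
qed

text \<open>This is the reflection of \<open>C\<close> in a simple root, transported by u. Appending
  a letter on the right thus passes to a neighbouring chamber, which is why words read from the left
  are galleries.\<close>

lemma act_snoc_image:
  assumes "u \<in> lists I" "s \<in> I"
  shows "act (u @ [s]) ` C = insert (- act u (\<alpha> s)) (act u ` C - {act u (\<alpha> s)})"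
proof -
  have inj: "inj (act u)" using act_rev_act[OF assms(1)] by (metis injI)
  have "act (u @ [s]) ` C = act u ` (insert (- \<alpha> s) (C - {\<alpha> s}))"
    unfolding act_append_image using refl_simple_image[OF alpha_simple[OF assms(2)]] by simp
  also have "\<dots> = insert (- act u (\<alpha> s)) (act u ` C - act u ` {\<alpha> s})"
    using image_set_diff[OF inj, of C "{\<alpha> s}"] by (simp add: act_minus)
  finally show ?thesis by simp
qed

lemma finite_inversions: "u \<in> lists I \<Longrightarrow> finite (C - act u ` C)"
proof (induction u rule: rev_induct)
  case (snoc s u)
  then have us: "u \<in> lists I" "s \<in> I" by auto
  have "C - act (u @ [s]) ` C \<subseteq> insert (act u (\<alpha> s)) (C - act u ` C)"
    unfolding act_snoc_image[OF us] by blast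
  then show ?case by (rule finite_subset) (use snoc.IH us in simp)
qed simp

text \<open>Takes the place of Coxeter length. It depends on \<open>act u\<close> alone and so is at
  hand before anything is known about equality of words in the group.\<close>

definition depth :: "'i list \<Rightarrow> nat" where
  "depth u = card (C - act u ` C)"

lemma depth_Nil [simp]: "depth [] = 0"
  by (simp add: depth_def)

lemma depth_eq_0_iff:
  assumes "u \<in> lists I"
  shows "depth u = 0 \<longleftrightarrow> act u ` C = C"
proof -
  have "depth u = 0 \<longleftrightarrow> C \<subseteq> act u ` C"
    using finite_inversions[OF assms] by (auto simp: depth_def)
  then show ?thesis using hemispace_eqI[OF C_hemispace act_C_hemispace[OF assms]] by auto
qed


lemma depth_snoc:
  assumes u: "u \<in> lists I" and s: "s \<in> I"
  shows "act u (\<alpha> s) \<in> C \<Longrightarrow> depth (u @ [s]) = Suc (depth u)"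
    and "act u (\<alpha> s) \<notin> C \<Longrightarrow> depth u = Suc (depth (u @ [s]))"
proof -
  let ?a = "act u (\<alpha> s)" and ?F = "act u ` C"
  have aU: "?a \<in> U" and aF: "?a \<in> ?F" using act_U[OF u alpha_U[OF s]] alpha_C[OF s] by auto
  have mF: "- ?a \<notin> ?F"
    using hemispace_uminus_iff[OF act_C_hemispace[OF u] aU] aF by blast
  note fin = finite_inversions[OF u] and im = act_snoc_image[OF u s] and m = C_uminus[OF aU]
  show "depth (u @ [s]) = Suc (depth u)" if "?a \<in> C"
  proof -
    have "C - act (u @ [s]) ` C = insert ?a (C - ?F)"
      unfolding im using that m by auto
    then show ?thesis using fin aF by (simp add: depth_def)
  qed
  show "depth u = Suc (depth (u @ [s]))" if "?a \<notin> C"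
  proof -
    have "C - ?F = insert (- ?a) (C - act (u @ [s]) ` C)"
      unfolding im using that m mF by auto
    moreover have "- ?a \<notin> C - act (u @ [s]) ` C" unfolding im by auto
    moreover have "finite (C - act (u @ [s]) ` C)" using finite_inversions[of "u @ [s]"] u s by auto
    ultimately show ?thesis by (simp add: depth_def)
  qed
qed

lemma depth_snoc_less_iff:
  assumes "u \<in> lists I" "s \<in> I"
  shows "depth (u @ [s]) < depth u \<longleftrightarrow> act u (\<alpha> s) \<notin> C"
  using depth_snoc[OF assms] by (cases "act u (\<alpha> s) \<in> C") auto

text \<open>Each letter changes the depth by exactly one. Consequently no word of odd length
  stabilises \<open>C\<close>.\<close>

lemma even_depth: "u \<in> lists I \<Longrightarrow> even (depth u) \<longleftrightarrow> even (length u)"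
proof (induction u rule: rev_induct)
  case (snoc s u)
  then show ?case using depth_snoc[of u s] by (cases "act u (\<alpha> s) \<in> C") auto
qed simp

theorem hemispace_orbit:
  assumes "F \<in> hemispaces U" "finite (C - F)"
  shows "\<exists>u\<in>lists I. F = act u ` C"
  using assms
proof (induction "card (C - F)" arbitrary: F rule: less_induct)
  case less
  show ?case
  proof (cases "C = F")
    case True
    then show ?thesis by (intro bexI[of _ "[]"]) auto
  next
    case False
    from simple_in_difference[OF less.prems False] obtain a where "a \<in> simple" "a \<notin> F" by blast
    then obtain s where s: "s \<in> I" "\<alpha> s \<notin> F" by (metis simple_alphaE)
    let ?r = "refl (\<alpha> s)"
    note sU = alpha_U[OF s(1)]
    have rr: "?r (?r x) = x" for x using refl_refl[OF sU] .
    have G: "?r ` F \<in> hemispaces U"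
      by (rule hemispace_linear_image[OF less.prems(1) linear_refl rr]) (auto simp: refl_in_U sU)
    have "- \<alpha> s \<in> F" using s hemispace_uminus_iff[OF less.prems(1) sU] by blast
    have inj: "inj ?r" using rr by (metis injI)
    have "C = ?r ` ?r ` C" by (simp add: image_image rr)
    then have "C - ?r ` F = ?r ` (?r ` C - F)" by (simp add: image_set_diff[OF inj])
    \<comment> \<open>The reflection replaces \<alpha> s by its negative, which lies in
      \<open>F\<close>, and permutes the rest of \<open>C\<close>; so exactly one element of the
      difference disappears.\<close>
    also have "?r ` C - F = (C - F) - {\<alpha> s}"
      using refl_simple_image[OF alpha_simple[OF s(1)]] \<open>- \<alpha> s \<in> F\<close> by auto
    finally have D: "C - ?r ` F = ?r ` ((C - F) - {\<alpha> s})" .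
    have "card (C - ?r ` F) \<le> card ((C - F) - {\<alpha> s})"
      unfolding D using less.prems by (intro card_image_le) auto
    also have "\<dots> < card (C - F)"
      using less.prems s alpha_C[OF s(1)] by (intro card_Diff1_less) auto
    finally have "card (C - ?r ` F) < card (C - F)" .
    moreover have "finite (C - ?r ` F)" unfolding D using less.prems by auto
    ultimately obtain u where u: "u \<in> lists I" "?r ` F = act u ` C"
      using less.hyps G by blast
    have "F = ?r ` ?r ` F" by (simp add: image_image rr)
    then have "F = act (s # u) ` C" unfolding u(2) by (simp add: image_image)
    then show ?thesis using u s by (intro bexI[of _ "s # u"]) auto
  qed
qed

text \<open>u sends a simple root out of \<open>C\<close> exactly if the image of \<open>C\<close>
  under the inverse word omits it, so \<open>simple_in_difference\<close> is applied to
  \<open>rev u\<close>.\<close>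

lemma exists_descent:
  assumes "u \<in> lists I" "act u ` C \<noteq> C"
  shows "\<exists>s\<in>I. act u (\<alpha> s) \<notin> C"
proof -
  have r: "rev u \<in> lists I" using assms by auto
  have "act (rev u) ` C \<noteq> C"
  proof
    assume "act (rev u) ` C = C"
    then have "act u ` C = act u ` act (rev u) ` C" by simp
    also have "\<dots> = C" using act_act_rev[OF assms(1)] by (simp add: image_image)
    finally show False using assms by simp
  qed
  from simple_in_difference[OF act_C_hemispace[OF r] finite_inversions[OF r]] this
  obtain a where "a \<in> simple" "a \<notin> act (rev u) ` C" by metis
  then obtain s where "s \<in> I" "\<alpha> s \<notin> act (rev u) ` C" by (metis simple_alphaE)
  then show ?thesis using mem_act_image[OF r] by auto
qed

text \<open>While the letters of y are applied to v one by one, it can leave \<open>C\<close> only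
  as the simple root of the current letter; until then it has changed only by multiples of \<alpha>
  s and \<alpha> t.\<close>

lemma rank2_inversion:
  assumes st: "s \<in> I" "t \<in> I" "s \<noteq> t" and y: "y \<in> lists {s, t}"
    and v: "v \<in> C" "act (rev y) v \<notin> C"
  shows "\<exists>p q. 0 \<le> p \<and> 0 \<le> q \<and> v = p *\<^sub>R \<alpha> s + q *\<^sub>R \<alpha> t"
proof -
  have "\<exists>p q. v = p *\<^sub>R \<alpha> s + q *\<^sub>R \<alpha> t"
    using y v
  proof (induction y arbitrary: v)
    case (Cons r y)
    have r: "r = s \<or> r = t" "r \<in> I" using Cons.hyps st by auto
    show ?case
    proof (cases "refl (\<alpha> r) v \<in> C")
      case True
      then obtain p q where "refl (\<alpha> r) v = p *\<^sub>R \<alpha> s + q *\<^sub>R \<alpha> t"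
        using Cons.IH[of "refl (\<alpha> r) v"] Cons.prems by auto
      moreover define k where "k = 2 * B v (\<alpha> r)"
      ultimately have "v = p *\<^sub>R \<alpha> s + q *\<^sub>R \<alpha> t + k *\<^sub>R \<alpha> r"
        by (simp add: refl_def diff_eq_eq)
      then have "v = (p + k) *\<^sub>R \<alpha> s + q *\<^sub>R \<alpha> t \<or> v = p *\<^sub>R \<alpha> s + (q + k) *\<^sub>R \<alpha> t"
        using r(1) by (elim disjE) (simp_all add: scaleR_add_left add_ac)
      then show ?thesis by blast
    next
      case False
      then have "v = \<alpha> r" using refl_simple_C[OF alpha_simple[OF r(2)]] Cons.prems by blast
      then have "v = 1 *\<^sub>R \<alpha> s + 0 *\<^sub>R \<alpha> t \<or> v = 0 *\<^sub>R \<alpha> s + 1 *\<^sub>R \<alpha> t"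
        using r(1) by auto
      then show ?thesis by blast
    qed
  qed auto
  then show ?thesis
    using simple_comb_nonneg[OF alpha_simple alpha_simple, of s t] st alpha_eq_iff v(1) by blast
qed

text \<open>If both \<open>s\<close> and \<open>t\<close> are descents of \<open>u\<close>, then \<open>u\<close> is the deepest element of its coset
  modulo \<open>\<langle>s, t\<rangle>\<close>.\<close>

lemma depth_below_peak:
  assumes u: "u \<in> lists I" and st: "s \<in> I" "t \<in> I" "s \<noteq> t"
    and d: "act u (\<alpha> s) \<notin> C" "act u (\<alpha> t) \<notin> C"
    and y: "y \<in> lists {s, t}" "act y ` C \<noteq> C"
  shows "depth (u @ y) < depth u"
proof -
  have yI: "y \<in> lists I" using y st by auto
  \<comment> \<open>A root inverted by y is a nonnegative combination of \<alpha> s and \<alpha> t,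
    and u makes both negative.\<close>
  have key: "act u v \<notin> C" if v: "v \<in> C" "v \<notin> act y ` C" for v
  proof
    assume "act u v \<in> C"
    obtain p q where pq: "0 \<le> p" "0 \<le> q" "v = p *\<^sub>R \<alpha> s + q *\<^sub>R \<alpha> t"
      using rank2_inversion[OF st y(1)] v mem_act_image[OF yI] by blast
    have mem: "- act u (\<alpha> s) \<in> C" "- act u (\<alpha> t) \<in> C"
      using d C_uminus[OF act_U[OF u alpha_U]] st by auto
    have "p *\<^sub>R (- act u (\<alpha> s)) + q *\<^sub>R (- act u (\<alpha> t)) \<in> sum_cone C"
      using mem pq by (intro sum_cone_add sum_cone_scaleR sum_cone_base)
    moreover have "p *\<^sub>R (- act u (\<alpha> s)) + q *\<^sub>R (- act u (\<alpha> t)) = - act u v"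
      unfolding pq(3) by (simp add: act_add act_scaleR)
    ultimately have "- act u v \<in> sum_cone C" by simp
    moreover have "act u v \<in> U" using act_U[OF u] C_U v by blast
    ultimately have "- act u v \<in> C" using C_cone U_uminus by blast
    then show False using C_uminus \<open>act u v \<in> U\<close> \<open>act u v \<in> C\<close> by blast
  qed
  have "C - act (u @ y) ` C \<subseteq> C - act u ` C"
  proof
    fix x assume x: "x \<in> C - act (u @ y) ` C"
    have "x \<notin> act u ` C"
    proof
      assume "x \<in> act u ` C"
      then obtain v where v: "v \<in> C" "x = act u v" by blast
      then have "v \<notin> act y ` C" using x by (auto simp: image_image)
      then show False using key v x by blast
    qed
    then show "x \<in> C - act u ` C" using x by blast
  qed
  \<comment> \<open>Strictness: for a root v of \<open>C\<close> inverted by y, the root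
    -\<open>act u v\<close> is inverted by u but not by \<open>u @ y\<close>.\<close>
  moreover have "\<exists>x. x \<in> C - act u ` C \<and> x \<notin> C - act (u @ y) ` C"
  proof -
    have "\<not> C \<subseteq> act y ` C"
      using hemispace_eqI[OF C_hemispace act_C_hemispace[OF yI]] y(2) by blast
    then obtain v where v: "v \<in> C" "v \<notin> act y ` C" by blast
    have vU: "v \<in> U" using v C_U by blast
    have "- act u v \<in> C" using key[OF v] C_uminus[OF act_U[OF u vU]] by blast
    moreover have "- act u v \<notin> act u ` C"
      using hemispace_uminus_iff[OF act_C_hemispace[OF u] act_U[OF u vU]] v by blast
    moreover have "- v \<in> act y ` C"
      using hemispace_uminus_iff[OF act_C_hemispace[OF yI] vU] v by blast
    then have "- act u v \<in> act (u @ y) ` C"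
      unfolding act_append_image using act_minus[of u v] by (metis imageI)
    ultimately show ?thesis by blast
  qed
  ultimately have "C - act (u @ y) ` C \<subset> C - act u ` C" by blast
  then show ?thesis
    unfolding depth_def by (rule psubset_card_mono[OF finite_inversions[OF u]])
qed

lemma refl_comb_left:
  assumes "a \<in> U"
  shows "refl a (v + p *\<^sub>R a + q *\<^sub>R b) =
    v + (- p - 2 * B v a - 2 * B a b * q) *\<^sub>R a + q *\<^sub>R b"
proof -
  have "2 * B (v + p *\<^sub>R a + q *\<^sub>R b) a = 2 * p + 2 * B v a + 2 * B a b * q"
    by (simp add: B_simps B_unit[OF assms] B_commute[of b a])
  moreover have "v + p *\<^sub>R a + q *\<^sub>R b - k *\<^sub>R a = v + (p - k) *\<^sub>R a + q *\<^sub>R b" for k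
    by (simp add: algebra_simps)
  ultimately show ?thesis by (simp add: refl_def)
qed

lemma act_rot:
  assumes st: "s \<in> I" "t \<in> I"
    and "(dih (B (\<alpha> s) (\<alpha> t)) (B v (\<alpha> s)) (B v (\<alpha> t)) ^^ k) (0, 0) = (p, q)"
  shows "act (rot k s t) v = v + p *\<^sub>R \<alpha> s + q *\<^sub>R \<alpha> t"
  using assms(3)
proof (induction k arbitrary: p q)
  case (Suc k)
  let ?d = "dih (B (\<alpha> s) (\<alpha> t)) (B v (\<alpha> s)) (B v (\<alpha> t))"
  obtain p' q' where pq': "(?d ^^ k) (0, 0) = (p', q')" by fastforce
  define q'' where "q'' = - q' - 2 * B v (\<alpha> t) - 2 * B (\<alpha> s) (\<alpha> t) * p'"
  have q: "q = q''" and p: "p = - p' - 2 * B v (\<alpha> s) - 2 * B (\<alpha> s) (\<alpha> t) * q''"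
    using Suc.prems pq' by (auto simp: dih_def Let_def q''_def)
  have "act (rot (Suc k) s t) v = refl (\<alpha> s) (refl (\<alpha> t) (v + p' *\<^sub>R \<alpha> s + q' *\<^sub>R \<alpha> t))"
    using Suc.IH[OF pq'] by simp
  also have "refl (\<alpha> t) (v + p' *\<^sub>R \<alpha> s + q' *\<^sub>R \<alpha> t) = v + p' *\<^sub>R \<alpha> s + q'' *\<^sub>R \<alpha> t"
    using refl_comb_left[OF alpha_U[OF st(2)], of v q' p' "\<alpha> s"]
    by (simp add: q''_def B_commute[of "\<alpha> t" "\<alpha> s"] add.assoc add.commute[of "_ *\<^sub>R \<alpha> t"])
  also have "refl (\<alpha> s) \<dots> = v + p *\<^sub>R \<alpha> s + q *\<^sub>R \<alpha> t"
    unfolding p q by (rule refl_comb_left[OF alpha_U[OF st(1)]])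
  finally show ?case .
qed auto

lemma act_rot_cox_mat:
  assumes st: "s \<in> I" "t \<in> I"
  shows "act (rot (cox_mat s t) s t) v = v"
proof (cases "s = t")
  case True
  then show ?thesis using refl_refl alpha_U st by (simp add: cox_mat_def)
next
  case False
  then show ?thesis
    using act_rot[OF st, where v = v and k = "cox_mat s t" and p = 0 and q = 0] dih_bond[OF B_alpha_cases[OF st False]]
    by (simp add: cox_mat_def)
qed

lemma act_coxeter_rel:
  assumes "(u, v) \<in> coxeter_rel I cox_mat"
  shows "act u = act v"
  using assms
proof (induction rule: coxeter_rel_induct)
  case (step x y)
  then have "act x = act y"
    by (induction rule: coxeter_step.induct) (auto simp: fun_eq_iff act_rot_cox_mat simp del: concat_replicate_trivial)
  then show ?case by simp
qed simp

text \<open>If \<open>C\<close> were fixed, the image of \<alpha> t would have nonnegative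
  coordinates by \<open>simple_comb_nonneg\<close> and nonpositive ones by
  \<open>dih_negative\<close>, and so vanish.\<close>

lemma act_rot_image_neq_half:
  assumes st: "s \<in> I" "t \<in> I" "s \<noteq> t" and j: "0 < j" "2 * j \<le> cox_mat s t"
  shows "act (rot j s t) ` C \<noteq> C"
proof
  assume eq: "act (rot j s t) ` C = C"
  let ?c = "B (\<alpha> s) (\<alpha> t)"
  obtain p q where pq: "(dih ?c ?c 1 ^^ j) (0, 0) = (p, q)" by fastforce
  have le: "p \<le> 0" "1 + q \<le> 0"
    using dih_negative[OF B_alpha_cases[OF st] j(1) _ pq] j(2) st(3) by (auto simp: cox_mat_def)
  have "act (rot j s t) (\<alpha> t) = \<alpha> t + p *\<^sub>R \<alpha> s + q *\<^sub>R \<alpha> t"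
    using pq B_unit[OF alpha_U[OF st(2)]]
    by (intro act_rot[OF st(1,2)]) (simp add: B_commute[of "\<alpha> t" "\<alpha> s"])
  then have "p *\<^sub>R \<alpha> s + (1 + q) *\<^sub>R \<alpha> t = act (rot j s t) (\<alpha> t)"
    by (simp add: algebra_simps)
  moreover have mem: "act (rot j s t) (\<alpha> t) \<in> C" using eq alpha_C[OF st(2)] by blast
  ultimately have "0 \<le> p" "0 \<le> 1 + q"
    using simple_comb_nonneg[OF alpha_simple[OF st(1)] alpha_simple[OF st(2)], of p "1 + q"]
      alpha_eq_iff st by auto
  then have "p = 0" "1 + q = 0" using le by auto
  then have "act (rot j s t) (\<alpha> t) = 0"
    using \<open>p *\<^sub>R \<alpha> s + (1 + q) *\<^sub>R \<alpha> t = act (rot j s t) (\<alpha> t)\<close> by (simp del: add_eq_0_iff)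
  then show False using mem C_nonzero by blast
qed

text \<open>Beyond the half turn the complementary power takes over: the full turn is trivial, so it
  would fix \<open>C\<close> too.\<close>

lemma act_rot_image_neq:
  assumes st: "s \<in> I" "t \<in> I" "s \<noteq> t" and j: "0 < j" "j < cox_mat s t"
  shows "act (rot j s t) ` C \<noteq> C"
proof (cases "2 * j \<le> cox_mat s t")
  case True
  then show ?thesis using act_rot_image_neq_half[OF st j(1)] by blast
next
  case False
  let ?k = "cox_mat s t - j"
  show ?thesis
  proof
    assume eq: "act (rot j s t) ` C = C"
    have "act (rot (?k + j) s t) ` C = C"
      using j act_rot_cox_mat[OF st(1,2)] by simp
    then have "act (rot ?k s t) ` C = C"
      unfolding rot_add act_append_image eq .
    then show False using act_rot_image_neq_half[OF st, of ?k] False j by simp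
  qed
qed

text \<open>For \<open>m s t = \<infinity>\<close> the vectors \<open>\<alpha>\<^sub>s + 2 n (\<alpha>\<^sub>s + \<alpha>\<^sub>t)\<close> would all be inversions.\<close>

lemma cox_mat_peak_neq_0:
  assumes u: "u \<in> lists I" and st: "s \<in> I" "t \<in> I" "s \<noteq> t"
    and d: "act u (\<alpha> s) \<notin> C" "act u (\<alpha> t) \<notin> C"
  shows "cox_mat s t \<noteq> 0"
proof
  assume "cox_mat s t = 0"
  then have "bond (B (\<alpha> s) (\<alpha> t)) = 0" using st(3) by (simp add: cox_mat_def)
  with B_alpha_cases[OF st] have c: "B (\<alpha> s) (\<alpha> t) = - 1"
    by (cases rule: bond_cases) simp_all
  let ?a = "\<alpha> s" and ?d = "\<alpha> s + \<alpha> t"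
  have B: "B ?a ?a = 1" "B (\<alpha> t) (\<alpha> t) = 1" "B (\<alpha> t) ?a = - 1"
    using B_unit alpha_U st c by (auto simp: B_commute)
  \<comment> \<open>\<open>?d\<close> is orthogonal to both simple roots, so that one rotation
    translates \<open>v n\<close> by twice \<open>?d\<close>.\<close>
  define v where "v n = ?a + (2 * real n) *\<^sub>R ?d" for n
  have vU: "v n \<in> U" for n
  proof (induction n)
    case 0
    then show ?case by (simp add: v_def alpha_U st)
  next
    case (Suc n)
    have rt: "refl (\<alpha> t) (v n) = v n + 2 *\<^sub>R \<alpha> t"
      by (simp add: refl_def v_def B_simps B c)
    have "refl ?a (v n + 2 *\<^sub>R \<alpha> t) = v n + 2 *\<^sub>R \<alpha> t + 2 *\<^sub>R ?a"
      by (simp add: refl_def v_def B_simps B c)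
    also have "\<dots> = v (Suc n)" by (simp add: v_def algebra_simps)
    finally have "v (Suc n) = refl ?a (refl (\<alpha> t) (v n))" using rt by simp
    then show ?case using Suc refl_in_U alpha_U st by simp
  qed
  have vcomb: "v n = (1 + 2 * real n) *\<^sub>R ?a + (2 * real n) *\<^sub>R \<alpha> t" for n
    by (simp add: v_def algebra_simps)
  have vC: "v n \<in> C" for n
  proof (rule C_cone[OF _ vU])
    show "v n \<in> sum_cone C"
      unfolding vcomb using alpha_C st by (intro sum_cone_add sum_cone_scaleR sum_cone_base) auto
  qed
  have inv: "- act u (v n) \<in> C" for n
  proof (rule C_cone)
    have mem: "- act u (\<alpha> s) \<in> C" "- act u (\<alpha> t) \<in> C"
      using d C_uminus[OF act_U[OF u alpha_U]] st by auto
    have "(1 + 2 * real n) *\<^sub>R (- act u ?a) + (2 * real n) *\<^sub>R (- act u (\<alpha> t)) \<in> sum_cone C"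
      using mem by (intro sum_cone_add sum_cone_scaleR sum_cone_base) auto
    then show "- act u (v n) \<in> sum_cone C" unfolding vcomb by (simp add: act_add act_scaleR)
    show "- act u (v n) \<in> U" using U_uminus act_U[OF u vU] by blast
  qed
  have "- act u (v n) \<in> C - act u ` C" for n
    using inv[of n] hemispace_uminus_iff[OF act_C_hemispace[OF u] act_U[OF u vU[of n]]] vC[of n]
    by blast
  then have "range (\<lambda>n. - act u (v n)) \<subseteq> C - act u ` C" by (rule image_subsetI)
  moreover have "inj (\<lambda>n. - act u (v n))"
  proof (rule injI)
    fix i j assume "- act u (v i) = - act u (v j)"
    then have "v i = v j" using act_rev_act[OF u] by (metis neg_equal_iff_equal)
    moreover have "?d \<noteq> 0" using C_pointed[of ?a "\<alpha> t" 1] alpha_C st sum_cone_base[of "\<alpha> t" C] by simp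
    ultimately show "i = j" by (simp add: v_def)
  qed
  ultimately show False
    using finite_inversions[OF u] by (meson finite_subset finite_imageD infinite_UNIV_nat)
qed

section \<open>Faithfulness\<close>

text \<open>The base \<open>12\<close> makes one step at height \<open>d\<close> outweigh the at most ten steps of smaller height
  by which it gets replaced, as \<open>2 (m - 1) \<le> 10\<close> for \<open>m \<in> {2, 3, 4, 6}\<close>.\<close>

fun weight :: "'i list \<Rightarrow> 'i list \<Rightarrow> nat" where
  "weight u [] = 0"
| "weight u (s # w) = 12 ^ depth (u @ [s]) + weight (u @ [s]) w"

lemma weight_append: "weight u (v @ w) = weight u v + weight (u @ v) w"
  by (induction v arbitrary: u) auto

lemma weight_cong:
  assumes "act u = act v"
  shows "weight u w = weight v w"
  using assms
proof (induction w arbitrary: u v)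
  case (Cons s w)
  have "act (u @ [s]) = act (v @ [s])" using Cons.prems by (simp add: fun_eq_iff)
  then show ?case using Cons.IH by (simp add: depth_def)
qed simp

lemma weight_bound:
  assumes "\<And>x y. w = x @ y \<Longrightarrow> x \<noteq> [] \<Longrightarrow> depth (u @ x) < d"
  shows "weight u w \<le> length w * 12 ^ (d - 1)"
  using assms
proof (induction w arbitrary: u)
  case (Cons s w)
  have "depth (u @ [s]) < d" using Cons.prems[of "[s]" w] by simp
  then have "12 ^ depth (u @ [s]) \<le> (12 :: nat) ^ (d - 1)" by (intro power_increasing) auto
  moreover have "weight (u @ [s]) w \<le> length w * 12 ^ (d - 1)"
  proof (rule Cons.IH)
    fix x y assume "w = x @ y" "x \<noteq> []"
    then show "depth ((u @ [s]) @ x) < d" using Cons.prems[of "s # x" y] by simp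
  qed
  ultimately show ?case by (simp only: weight.simps list.size add_mult_distrib)
qed simp

text \<open>A nonempty gallery returning to depth 0 cannot rise at every step, and its first
  descending letter is preceded by an ascending one.\<close>

lemma local_peak:
  assumes "u \<noteq> []" "u \<in> lists I" "act u ` C = C"
  shows "\<exists>p s t q. u = p @ [s, t] @ q \<and> act p (\<alpha> s) \<in> C \<and> act (p @ [s]) (\<alpha> t) \<notin> C"
proof -
  have "\<exists>x t y. w = x @ [t] @ y \<and> act (v @ x) (\<alpha> t) \<notin> C"
    if "v \<in> lists I" "w \<in> lists I" "depth (v @ w) < depth v + length w" for v w
    using that
  proof (induction w arbitrary: v)
    case (Cons t w)
    show ?case
    proof (cases "act v (\<alpha> t) \<in> C")
      case True
      then have "depth (v @ [t]) = Suc (depth v)" using depth_snoc Cons.prems by auto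
      then obtain x r y where "w = x @ [r] @ y" "act ((v @ [t]) @ x) (\<alpha> r) \<notin> C"
        using Cons.IH[of "v @ [t]"] Cons.prems by auto
      then show ?thesis by (intro exI[of _ "t # x"]) auto
    next
      case False
      then show ?thesis by (intro exI[of _ "[]"]) auto
    qed
  qed simp
  from this[of "[]" u] have "\<exists>x t y. u = x @ [t] @ y \<and> act x (\<alpha> t) \<notin> C"
    using assms depth_eq_0_iff[OF assms(2)] by simp
  then have ex: "\<exists>n x t y. n = length x \<and> u = x @ [t] @ y \<and> act x (\<alpha> t) \<notin> C" by blast
  define n where "n = (LEAST n. \<exists>x t y. n = length x \<and> u = x @ [t] @ y \<and> act x (\<alpha> t) \<notin> C)"
  from LeastI_ex[OF ex] obtain x t y where x: "n = length x" "u = x @ [t] @ y" "act x (\<alpha> t) \<notin> C"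
    unfolding n_def by blast
  \<comment> \<open>The first letter cannot descend, since \<alpha> t itself lies in
    \<open>C\<close>.\<close>
  have "x \<noteq> []" using x alpha_C assms by auto
  then obtain p s where p: "x = p @ [s]" by (metis append_butlast_last_id)
  have "act p (\<alpha> s) \<in> C"
  proof (rule ccontr)
    assume "act p (\<alpha> s) \<notin> C"
    then have "length p = length p \<and> u = p @ [s] @ (t # y) \<and> act p (\<alpha> s) \<notin> C"
      using x(2) p by simp
    then have "n \<le> length p" unfolding n_def by (intro Least_le) blast
    then show False using x(1) p by simp
  qed
  then show ?thesis using x p by auto
qed

text \<open>From the peak, the chamber after \<open>x\<close> is reached by the word
  \<open>s # x\<close>, so \<open>depth_below_peak\<close> applies once this word is known to move
  \<open>C\<close>. For odd length that is parity, for even length the order of the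
  rotation.\<close>

lemma rot_detour_below_peak:
  assumes p: "p \<in> lists I" and st: "s \<in> I" "t \<in> I" "s \<noteq> t"
    and d: "act p (\<alpha> s) \<in> C" "act (p @ [s]) (\<alpha> t) \<notin> C"
    and x: "rot (cox_mat s t - 1) t s = x @ y" and m: "cox_mat s t \<noteq> 0"
  shows "depth (p @ x) < depth (p @ [s])"
proof -
  have ps: "p @ [s] \<in> lists I" using p st by auto
  have "act (p @ [s]) (\<alpha> s) = - act p (\<alpha> s)"
    using refl_self[OF alpha_U[OF st(1)]] by (simp add: act_minus)
  then have ds: "act (p @ [s]) (\<alpha> s) \<notin> C"
    using d C_uminus[OF act_U[OF p alpha_U[OF st(1)]]] by simp
  obtain j where j: "x = rot j t s \<and> j \<le> cox_mat s t - 1 \<or> x = rot j t s @ [t] \<and> j < cox_mat s t - 1"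
    using rot_prefix[OF x[symmetric]] by blast
  have x_st: "x \<in> lists {s, t}" using j rot_in_lists[of t "{s, t}" s j] by auto
  have "act (s # x) ` C \<noteq> C"
    using j
  proof
    assume "x = rot j t s \<and> j \<le> cox_mat s t - 1"
    then have "odd (length (s # x))" by (simp add: length_rot)
    moreover have sx: "s # x \<in> lists I" using x_st st by auto
    ultimately have "depth (s # x) \<noteq> 0" using even_depth[OF sx] by (metis even_zero)
    then show ?thesis by (simp only: depth_eq_0_iff[OF sx] not_False_eq_True)
  next
    assume "x = rot j t s @ [t] \<and> j < cox_mat s t - 1"
    then have "s # x = rot (Suc j) s t" "Suc j < cox_mat s t"
      using Cons_rot_snoc[of s j t] by auto
    then show ?thesis using act_rot_image_neq[OF st, of "Suc j"] by simp
  qed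
  then have "depth ((p @ [s]) @ (s # x)) < depth (p @ [s])"
    using x_st by (intro depth_below_peak[OF ps st ds d(2)]) auto
  moreover
  have "act ((p @ [s]) @ (s # x)) = act (p @ x)"
    using refl_refl[OF alpha_U[OF st(1)]] by (simp add: fun_eq_iff)
  then have "depth ((p @ [s]) @ (s # x)) = depth (p @ x)" by (simp only: depth_def)
  ultimately show ?thesis by (simp only:)
qed

text \<open>A word fixing \<open>C\<close> is a closed gallery; each of its local peaks \<open>s t\<close> can be bypassed along the
  other side of the rank two residue, which the word \<open>(t s)\<^sup>m\<^sup>-\<^sup>1\<close> traverses.\<close>

theorem stabilizer_trivial:
  assumes "u \<in> lists I" "act u ` C = C"
  shows "(u, []) \<in> coxeter_rel I cox_mat"
  using assms
proof (induction "weight [] u" arbitrary: u rule: less_induct)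
  case less
  show ?case
  proof (cases "u = []")
    case True
    then show ?thesis by (simp add: coxeter_rel_refl)
  next
    case False
    from local_peak[OF False less.prems] obtain p s t q where
      u: "u = p @ [s, t] @ q" and d: "act p (\<alpha> s) \<in> C" "act (p @ [s]) (\<alpha> t) \<notin> C" by blast
    have I: "p \<in> lists I" "q \<in> lists I" "s \<in> I" "t \<in> I" using less.prems u by auto
    \<comment> \<open>Any equivalent lighter word may replace the peak, because the tail q weighs
      the same after either.\<close>
    have reduce: ?thesis
      if rel: "([s, t], r) \<in> coxeter_rel I cox_mat" and w: "weight p r < weight p [s, t]" for r
    proof -
      have rel': "(u, p @ r @ q) \<in> coxeter_rel I cox_mat"
        unfolding u by (rule coxeter_rel_context[OF rel I(1,2)])
      have "act (p @ [s, t]) = act (p @ r)"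
        using act_coxeter_rel[OF rel] by (simp add: fun_eq_iff)
      then have "weight (p @ [s, t]) q = weight (p @ r) q" by (rule weight_cong)
      then have "weight [] (p @ r @ q) < weight [] u"
        using w unfolding u weight_append by simp
      moreover have "act (p @ r @ q) ` C = C"
        using act_coxeter_rel[OF rel'] less.prems(2) by simp
      ultimately have "(p @ r @ q, []) \<in> coxeter_rel I cox_mat"
        using less.hyps coxeter_rel_lists[OF rel'] by blast
      then show ?thesis using rel' coxeter_rel_trans by blast
    qed
    show ?thesis
    proof (cases "s = t")
      case True
      show ?thesis
        by (rule reduce[of "[]"]) (use True coxeter_rel_square[OF coxeter_matrix_cox_mat I(3)] in auto)
    next
      case False
      let ?m = "cox_mat s t"
      have ps: "p @ [s] \<in> lists I" using I by auto
      have "act (p @ [s]) (\<alpha> s) = - act p (\<alpha> s)"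
        using refl_self[OF alpha_U[OF I(3)]] by (simp add: act_minus)
      then have "act (p @ [s]) (\<alpha> s) \<notin> C"
        using d C_uminus[OF act_U[OF I(1) alpha_U[OF I(3)]]] by simp
      then have m: "?m \<noteq> 0" by (rule cox_mat_peak_neq_0[OF ps I(3,4) False _ d(2)])
      have m6: "?m \<le> 6" using False by (simp add: cox_mat_def bond_def)
      let ?h = "depth (p @ [s])"
      have h: "?h > 0" using depth_snoc(1)[OF I(1,3) d(1)] by simp
      have "weight p (rot (?m - 1) t s) \<le> length (rot (?m - 1) t s) * 12 ^ (?h - 1)"
        by (rule weight_bound) (rule rot_detour_below_peak[OF I(1,3,4) False d _ m])
      also have "\<dots> \<le> 10 * 12 ^ (?h - 1)" using m6 by (simp only: length_rot) simp
      also have "\<dots> < 12 * 12 ^ (?h - 1)" by simp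
      also have "\<dots> = 12 ^ ?h" using h by (simp add: power_eq_if)
      also have "\<dots> \<le> weight p [s, t]" by simp
      finally show ?thesis
        by (rule reduce[OF coxeter_rel_rot_flip[OF coxeter_matrix_cox_mat I(3,4) m]])
    qed
  qed
qed

end

section \<open>The geometric representation\<close>

lemma word_act_simps [simp]:
  "word_act m [] f = f"
  "word_act m (s # u) f = simple_refl m s (word_act m u f)"
  "word_act m (u @ w) f = word_act m u (word_act m w f)"
  by (simp_all add: word_act_def)

context simple_system
begin

definition root_space :: "('i \<Rightarrow> real) set" where
  "root_space = {f. finite {t. f t \<noteq> 0} \<and> {t. f t \<noteq> 0} \<subseteq> I}"

text \<open>Intertwines the geometric representation with \<open>act\<close>. It may have a kernel,
  as simple roots can be dependent, so identities in V' do not lift by themselves.\<close>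

definition emb :: "('i \<Rightarrow> real) \<Rightarrow> 'w" where
  "emb f = (\<Sum>t | f t \<noteq> 0. f t *\<^sub>R \<alpha> t)"

lemma emb_superset: "finite A \<Longrightarrow> {t. f t \<noteq> 0} \<subseteq> A \<Longrightarrow> emb f = (\<Sum>t\<in>A. f t *\<^sub>R \<alpha> t)"
  unfolding emb_def by (rule sum.mono_neutral_left) auto

lemma root_space_comb:
  assumes "f \<in> root_space" "g \<in> root_space"
  shows "(\<lambda>r. p * f r + q * g r) \<in> root_space"
proof -
  have "{t. p * f t + q * g t \<noteq> 0} \<subseteq> {t. f t \<noteq> 0} \<union> {t. g t \<noteq> 0}" by auto
  then show ?thesis using assms unfolding root_space_def
    by (auto intro: finite_subset)
qed

lemma emb_comb:
  assumes "f \<in> root_space" "g \<in> root_space"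
  shows "emb (\<lambda>r. p * f r + q * g r) = p *\<^sub>R emb f + q *\<^sub>R emb g"
proof -
  let ?A = "{t. f t \<noteq> 0} \<union> {t. g t \<noteq> 0}"
  have fin: "finite ?A" using assms by (auto simp: root_space_def)
  have "emb (\<lambda>r. p * f r + q * g r) = (\<Sum>t\<in>?A. (p * f t + q * g t) *\<^sub>R \<alpha> t)"
    by (rule emb_superset[OF fin]) auto
  also have "\<dots> = p *\<^sub>R (\<Sum>t\<in>?A. f t *\<^sub>R \<alpha> t) + q *\<^sub>R (\<Sum>t\<in>?A. g t *\<^sub>R \<alpha> t)"
    by (simp add: scaleR_add_left sum.distrib scaleR_sum_right)
  also have "\<dots> = p *\<^sub>R emb f + q *\<^sub>R emb g"
    using emb_superset[OF fin, of f] emb_superset[OF fin, of g] by auto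
  finally show ?thesis .
qed

lemma simple_root_in_root_space: "s \<in> I \<Longrightarrow> simple_root s \<in> root_space"
  by (auto simp: root_space_def simple_root_def)

lemma emb_simple_root: "emb (simple_root s) = \<alpha> s"
  using emb_superset[of "{s}" "simple_root s"] by (auto simp: simple_root_def)

lemma simple_refl_eq:
  assumes f: "f \<in> root_space" and s: "s \<in> I"
  shows "simple_refl cox_mat s f = (\<lambda>r. 1 * f r + (- 2 * B (emb f) (\<alpha> s)) * simple_root s r)"
proof -
  have B_sum: "B (\<Sum>t\<in>A. f t *\<^sub>R \<alpha> t) z = (\<Sum>t\<in>A. f t * B (\<alpha> t) z)" for A z
    by (induction A rule: infinite_finite_induct) (auto simp: B_simps)
  have "(\<Sum>t | f t \<noteq> 0. f t * coxeter_form cox_mat s t) = (\<Sum>t | f t \<noteq> 0. f t * B (\<alpha> t) (\<alpha> s))"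
    using f coxeter_form_cox_mat[OF s]
    by (intro sum.cong refl) (auto simp: root_space_def B_commute[of _ "\<alpha> s"])
  then show ?thesis by (simp add: simple_refl_def emb_def B_sum fun_eq_iff)
qed

lemma simple_refl_root_space:
  assumes "f \<in> root_space" "s \<in> I"
  shows "simple_refl cox_mat s f \<in> root_space"
  unfolding simple_refl_eq[OF assms]
  by (rule root_space_comb[OF assms(1) simple_root_in_root_space[OF assms(2)]])

lemma emb_simple_refl:
  assumes "f \<in> root_space" "s \<in> I"
  shows "emb (simple_refl cox_mat s f) = refl (\<alpha> s) (emb f)"
  unfolding simple_refl_eq[OF assms]
    emb_comb[OF assms(1) simple_root_in_root_space[OF assms(2)]]
  by (simp add: refl_def emb_simple_root)

lemma simple_refl_comb:
  assumes "f \<in> root_space" "g \<in> root_space" "s \<in> I"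
  shows "simple_refl cox_mat s (\<lambda>r. p * f r + q * g r) =
    (\<lambda>r. p * simple_refl cox_mat s f r + q * simple_refl cox_mat s g r)"
  unfolding simple_refl_eq[OF assms(1,3)] simple_refl_eq[OF assms(2,3)]
    simple_refl_eq[OF root_space_comb[OF assms(1,2)] assms(3)] emb_comb[OF assms(1,2)]
  by (simp add: fun_eq_iff B_simps algebra_simps)

lemma simple_refl_involution:
  assumes f: "f \<in> root_space" and s: "s \<in> I"
  shows "simple_refl cox_mat s (simple_refl cox_mat s f) = f"
proof -
  have "B (refl (\<alpha> s) v) (\<alpha> s) = - B v (\<alpha> s)" for v
    by (simp add: refl_def B_simps B_unit[OF alpha_U[OF s]])
  then have "simple_refl cox_mat s (simple_refl cox_mat s f) =
      (\<lambda>r. simple_refl cox_mat s f r + 2 * B (emb f) (\<alpha> s) * simple_root s r)"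
    using simple_refl_eq[OF simple_refl_root_space[OF f s] s] emb_simple_refl[OF f s] by simp
  then show ?thesis by (simp add: simple_refl_eq[OF f s])
qed

lemma word_act_root_space:
  "u \<in> lists I \<Longrightarrow> f \<in> root_space \<Longrightarrow> word_act cox_mat u f \<in> root_space"
  by (induction u) (auto simp: simple_refl_root_space)

lemma emb_word_act:
  "u \<in> lists I \<Longrightarrow> f \<in> root_space \<Longrightarrow> emb (word_act cox_mat u f) = act u (emb f)"
  by (induction u) (auto simp: emb_simple_refl word_act_root_space)

lemma word_act_comb:
  assumes "f \<in> root_space" "g \<in> root_space"
  shows "u \<in> lists I \<Longrightarrow> word_act cox_mat u (\<lambda>r. p * f r + q * g r) =
    (\<lambda>r. p * word_act cox_mat u f r + q * word_act cox_mat u g r)"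
  using assms by (induction u) (auto simp: simple_refl_comb word_act_root_space)

lemma word_act_rank2:
  assumes f: "f \<in> root_space" and st: "s \<in> I" "t \<in> I" and "y \<in> lists {s, t}"
  shows "\<exists>p q. word_act cox_mat y f = (\<lambda>r. f r + p * simple_root s r + q * simple_root t r)"
  using assms(4)
proof (induction y)
  case Nil
  show ?case by (intro exI[of _ 0]) simp
next
  case (Cons r y)
  then obtain p q where
    "word_act cox_mat y f = (\<lambda>r. f r + p * simple_root s r + q * simple_root t r)" by blast
  moreover have r: "r = s \<or> r = t" "r \<in> I" "y \<in> lists I" using Cons.hyps st by auto
  moreover define k where "k = - 2 * B (emb (word_act cox_mat y f)) (\<alpha> r)"
  ultimately have "word_act cox_mat (r # y) f =
      (\<lambda>r'. f r' + p * simple_root s r' + q * simple_root t r' + k * simple_root r r')"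
    using simple_refl_eq[OF word_act_root_space[OF r(3) f] r(2)] by simp
  then have "word_act cox_mat (r # y) f = (\<lambda>r'. f r' + (p + k) * simple_root s r' + q * simple_root t r') \<or>
      word_act cox_mat (r # y) f = (\<lambda>r'. f r' + p * simple_root s r' + (q + k) * simple_root t r')"
    using r(1) by (auto simp: algebra_simps fun_eq_iff)
  then show ?case by blast
qed

text \<open>Adding k times the relation leaves \<alpha> s and \<alpha> t unchanged, so the sign rule
  makes kp and kq nonnegative for k = 1 and for k = -1.\<close>

lemma alpha_independent:
  assumes st: "s \<in> I" "t \<in> I" "s \<noteq> t" and 0: "p *\<^sub>R \<alpha> s + q *\<^sub>R \<alpha> t = 0"
  shows "p = 0 \<and> q = 0"
proof -
  note nonneg = simple_comb_nonneg[OF alpha_simple[OF st(1)] alpha_simple[OF st(2)]]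
  have ne: "\<alpha> s \<noteq> \<alpha> t" using alpha_eq_iff st by simp
  have "(k * p) *\<^sub>R \<alpha> s + (k * q) *\<^sub>R \<alpha> t = 0" for k
    using arg_cong[OF 0, of "scaleR k"] by (simp add: scaleR_add_right)
  then have "(1 + k * p) *\<^sub>R \<alpha> s + (k * q) *\<^sub>R \<alpha> t = \<alpha> s"
    and "(k * p) *\<^sub>R \<alpha> s + (1 + k * q) *\<^sub>R \<alpha> t = \<alpha> t" for k
    by (simp_all add: scaleR_add_left add.assoc add.left_commute)
  then have "0 \<le> k * q" "0 \<le> k * p" for k
    using nonneg(2)[OF ne, of "1 + k * p" "k * q"] nonneg(1)[OF ne, of "k * p" "1 + k * q"]
      alpha_C st by auto
  from this[of 1] this[of "- 1"] show ?thesis by auto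
qed

text \<open>The word changes f only by a combination of two simple roots, where \<open>emb\<close>
  is injective; there the relation known for \<open>act\<close> does lift.\<close>

lemma word_act_rot_cox_mat:
  assumes f: "f \<in> root_space" and st: "s \<in> I" "t \<in> I"
  shows "word_act cox_mat (rot (cox_mat s t) s t) f = f"
proof (cases "s = t")
  case True
  then show ?thesis using simple_refl_involution[OF f] st by (simp add: cox_mat_def)
next
  case False
  let ?y = "rot (cox_mat s t) s t"
  have y: "?y \<in> lists {s, t}" "?y \<in> lists I" using st by (auto simp: rot_in_lists)
  obtain p q where "word_act cox_mat ?y f =
      (\<lambda>r. f r + p * simple_root s r + q * simple_root t r)"
    using word_act_rank2[OF f st y(1)] by blast
  then have eq: "word_act cox_mat ?y f =
      (\<lambda>r. 1 * f r + 1 * (p * simple_root s r + q * simple_root t r))"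
    by (simp add: add.assoc)
  note e = st[THEN simple_root_in_root_space]
  have "emb f = emb f + (p *\<^sub>R \<alpha> s + q *\<^sub>R \<alpha> t)"
    using emb_word_act[OF y(2) f]
    unfolding eq emb_comb[OF f root_space_comb[OF e]] emb_comb[OF e] emb_simple_root
      act_rot_cox_mat[OF st] by simp
  then have "p = 0 \<and> q = 0" using alpha_independent[OF st False] by simp
  then show ?thesis using eq by simp
qed

lemma word_act_coxeter_rel:
  assumes "(u, v) \<in> coxeter_rel I cox_mat" and f: "f \<in> root_space"
  shows "word_act cox_mat u f = word_act cox_mat v f"
  using assms(1)
proof (induction rule: coxeter_rel_induct)
  case (step x y)
  then have "word_act cox_mat x f = word_act cox_mat y f"
    by (induction rule: coxeter_step.induct)
      (simp add: word_act_rot_cox_mat word_act_root_space f)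
  then show ?case by simp
qed simp

text \<open>Gives \<open>the_elem\<close> in \<open>coxeter_act\<close> its meaning: all words of a
  class act alike on \<open>root_space\<close>.\<close>

lemma coxeter_act_class:
  assumes u: "u \<in> lists I" and f: "f \<in> root_space"
  shows "coxeter_act cox_mat (coxeter_class I cox_mat u) f = word_act cox_mat u f"
proof -
  have "(\<lambda>v. word_act cox_mat v f) ` coxeter_class I cox_mat u = {word_act cox_mat u f}"
    using word_act_coxeter_rel[OF _ f, of u] coxeter_rel_refl[OF u] by fastforce
  then show ?thesis by (simp add: coxeter_act_def)
qed

section \<open>Positive roots and inversion sets\<close>

abbreviation roots :: "('i \<Rightarrow> real) set" where
  "roots \<equiv> coxeter_roots I cox_mat"

abbreviation pos_roots :: "('i \<Rightarrow> real) set" where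
  "pos_roots \<equiv> coxeter_pos_roots I cox_mat"

lemma rootI: "u \<in> lists I \<Longrightarrow> s \<in> I \<Longrightarrow> word_act cox_mat u (simple_root s) \<in> roots"
  using coxeter_act_class[of u "simple_root s"] coxeter_class_carrier[of u I cox_mat]
    simple_root_in_root_space[of s]
  unfolding coxeter_roots_def by (intro CollectI exI conjI) auto

lemma rootE:
  assumes "\<psi> \<in> roots"
  obtains u s where "u \<in> lists I" "s \<in> I" "\<psi> = word_act cox_mat u (simple_root s)"
proof -
  from assms obtain w s where w: "\<psi> = coxeter_act cox_mat w (simple_root s)"
    "w \<in> carrier (coxeter_group I cox_mat)" "s \<in> I"
    unfolding coxeter_roots_def by blast
  from w(2) obtain u where "u \<in> lists I" "w = coxeter_class I cox_mat u"
    by (rule coxeter_group_carrierE)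
  then show ?thesis using that w coxeter_act_class simple_root_in_root_space by metis
qed

lemma root_in_root_space: "\<psi> \<in> roots \<Longrightarrow> \<psi> \<in> root_space"
  by (erule rootE) (simp add: word_act_root_space simple_root_in_root_space)

lemma emb_root: "\<psi> \<in> roots \<Longrightarrow> emb \<psi> \<in> U"
  by (erule rootE) (simp add: emb_word_act simple_root_in_root_space emb_simple_root act_U alpha_U)

lemma word_act_root: "u \<in> lists I \<Longrightarrow> \<psi> \<in> roots \<Longrightarrow> word_act cox_mat u \<psi> \<in> roots"
proof (erule rootE)
  fix w s
  assume "u \<in> lists I" "w \<in> lists I" "s \<in> I" "\<psi> = word_act cox_mat w (simple_root s)"
  then show ?thesis using rootI[of "u @ w" s] by auto
qed

lemma emb_minus:
  assumes "f \<in> root_space"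
  shows "emb (\<lambda>r. - f r) = - emb f"
  using emb_comb[OF assms assms, of "- 1" 0] by simp

lemma uminus_root:
  assumes "\<psi> \<in> roots"
  shows "(\<lambda>r. - \<psi> r) \<in> roots"
proof -
  obtain u s where u: "u \<in> lists I" "s \<in> I" "\<psi> = word_act cox_mat u (simple_root s)"
    using assms by (rule rootE)
  note e = simple_root_in_root_space[OF u(2)]
  have "simple_refl cox_mat s (simple_root s) = (\<lambda>r. - 1 * simple_root s r + 0 * simple_root s r)"
    unfolding simple_refl_eq[OF e u(2)] emb_simple_root
    by (simp add: B_unit[OF alpha_U[OF u(2)]])
  then have "word_act cox_mat (u @ [s]) (simple_root s) = (\<lambda>r. - \<psi> r)"
    using word_act_comb[OF e e u(1), of "- 1" 0] u(3) by simp
  then show ?thesis using rootI[of "u @ [s]" s] u by simp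
qed

text \<open>The induction is on the depth of \<open>u\<close>: the root lies in the span of the images of
  \<open>\<alpha>\<^sub>s\<close>, \<open>\<alpha>\<^sub>t\<close> under the shallowest element of the coset of \<open>u\<close> modulo \<open>\<langle>s, t\<rangle>\<close>, where
  \<open>t\<close> is a descent of \<open>u\<close>.\<close>

lemma word_act_simple_root_nonneg:
  assumes "u \<in> lists I" "s \<in> I" "act u (\<alpha> s) \<in> C"
  shows "0 \<le> word_act cox_mat u (simple_root s) r"
  using assms
proof (induction "depth u" arbitrary: u s rule: less_induct)
  case less
  note u = less.prems(1) and s = less.prems(2)
  note es = simple_root_in_root_space[OF s]
  show ?case
  proof (cases "act u ` C = C")
    case True
    \<comment> \<open>Faithfulness enters here: a word fixing \<open>C\<close> is trivial in the
      group and hence also in the geometric representation.\<close>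
    then have "word_act cox_mat u (simple_root s) = simple_root s"
      using word_act_coxeter_rel[OF stabilizer_trivial[OF u True] es] by simp
    then show ?thesis by (simp add: simple_root_def)
  next
    case False
    from exists_descent[OF u False] obtain t where t: "t \<in> I" "act u (\<alpha> t) \<notin> C" by blast
    have "s \<noteq> t" using less.prems t by auto
    note et = simple_root_in_root_space[OF t(1)]
    \<comment> \<open>y leads to the shallowest chamber of the coset. Neither s nor t is a descent
      there, so the induction hypothesis holds for both.\<close>
    obtain y where y: "y \<in> lists {s, t}"
      and least: "\<And>z. z \<in> lists {s, t} \<Longrightarrow> depth (u @ y) \<le> depth (u @ z)"
      using ex_has_least_nat[of "\<lambda>y. y \<in> lists {s, t}" "[]" "\<lambda>y. depth (u @ y)"] by auto
    have yI: "y \<in> lists I" "rev y \<in> lists I" using y s t by auto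
    define v where "v = u @ y"
    have v: "v \<in> lists I" using u yI by (simp add: v_def)
    have "depth v \<le> depth (u @ [t])" unfolding v_def by (rule least) simp
    also have "\<dots> < depth u" using depth_snoc_less_iff[OF u t(1)] t(2) by blast
    finally have vu: "depth v < depth u" .
    have vC: "act v (\<alpha> x) \<in> C" if "x \<in> {s, t}" for x
    proof (rule ccontr)
      assume "act v (\<alpha> x) \<notin> C"
      then have "depth (v @ [x]) < depth v" using depth_snoc_less_iff[OF v] that s t by blast
      moreover have "depth v \<le> depth (u @ (y @ [x]))"
        unfolding v_def by (rule least) (use y that in auto)
      ultimately show False by (simp add: v_def)
    qed
    have nn: "0 \<le> word_act cox_mat v (simple_root s) r" "0 \<le> word_act cox_mat v (simple_root t) r"
      using less.hyps[OF vu v s] less.hyps[OF vu v t(1)] vC by auto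
    have "rev y \<in> lists {s, t}" using y by auto
    from word_act_rank2[OF es s t(1) this] obtain p' q where
      "word_act cox_mat (rev y) (simple_root s) =
        (\<lambda>r. simple_root s r + p' * simple_root s r + q * simple_root t r)" by blast
    moreover define p where "p = 1 + p'"
    ultimately have pq: "word_act cox_mat (rev y) (simple_root s) =
        (\<lambda>r. p * simple_root s r + q * simple_root t r)" by (simp add: algebra_simps)
    have "(u @ y @ rev y, u @ []) \<in> coxeter_rel I cox_mat"
      by (rule coxeter_rel_append[OF coxeter_rel_refl[OF u]
            coxeter_rel_rev[OF coxeter_matrix_cox_mat yI(1)]])
    from word_act_coxeter_rel[OF this es]
    have eq: "word_act cox_mat u (simple_root s) =
        (\<lambda>r. p * word_act cox_mat v (simple_root s) r + q * word_act cox_mat v (simple_root t) r)"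
      using word_act_comb[OF es et v, of p q] pq by (simp add: v_def)
    have act_eq: "act (rev y) (\<alpha> s) = p *\<^sub>R \<alpha> s + q *\<^sub>R \<alpha> t"
      using emb_word_act[OF yI(2) es] unfolding pq emb_comb[OF es et] emb_simple_root by simp
    have act_u: "act u (\<alpha> s) = p *\<^sub>R act v (\<alpha> s) + q *\<^sub>R act v (\<alpha> t)"
      using emb_word_act[OF u es] emb_word_act[OF v es] emb_word_act[OF v et]
      unfolding eq emb_comb[OF word_act_root_space[OF v es] word_act_root_space[OF v et]]
        emb_simple_root by simp
    note nonneg = simple_comb_nonneg[OF alpha_simple[OF s] alpha_simple[OF t(1)]]
    have ne: "\<alpha> s \<noteq> \<alpha> t" using alpha_eq_iff s t \<open>s \<noteq> t\<close> by blast
    have bU: "act (rev y) (\<alpha> s) \<in> U" using act_U[OF yI(2) alpha_U[OF s]] .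
    \<comment> \<open>The rank two sign rule makes p and q both nonnegative or both nonpositive; the
      latter would send \<alpha> s out of \<open>C\<close> under u.\<close>
    show ?thesis
    proof (cases "act (rev y) (\<alpha> s) \<in> C")
      case True
      then have "0 \<le> p" "0 \<le> q" using nonneg[OF ne] unfolding act_eq by blast+
      then show ?thesis unfolding eq using nn by simp
    next
      case False
      then have "- act (rev y) (\<alpha> s) \<in> C" using C_uminus[OF bU] by blast
      then have "(- p) *\<^sub>R \<alpha> s + (- q) *\<^sub>R \<alpha> t \<in> C" unfolding act_eq by simp
      then have "0 \<le> - p" "0 \<le> - q" using nonneg[OF ne] by blast+
      then have "(- p) *\<^sub>R act v (\<alpha> s) + (- q) *\<^sub>R act v (\<alpha> t) \<in> sum_cone C"
        using vC by (intro sum_cone_add sum_cone_scaleR sum_cone_base) auto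
      moreover have "(- p) *\<^sub>R act v (\<alpha> s) + (- q) *\<^sub>R act v (\<alpha> t) = - act u (\<alpha> s)"
        unfolding act_u by simp
      ultimately have "- act u (\<alpha> s) \<in> sum_cone C" by simp
      then have "- act u (\<alpha> s) \<in> C"
        using C_cone U_uminus act_U[OF u alpha_U[OF s]] by blast
      then show ?thesis using less.prems(3) C_uminus act_U[OF u alpha_U[OF s]] by blast
    qed
  qed
qed

text \<open>Signs of coordinates cannot be read off from \<open>emb\<close>; the passage from
  \<open>C\<close> back to nonnegative coordinates rests on
  \<open>word_act_simple_root_nonneg\<close>.\<close>

lemma pos_root_iff:
  assumes "\<psi> \<in> roots"
  shows "\<psi> \<in> pos_roots \<longleftrightarrow> emb \<psi> \<in> C"
proof
  assume "\<psi> \<in> pos_roots"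
  then have nn: "0 \<le> \<psi> r" for r by (simp add: coxeter_pos_roots_def)
  have "emb \<psi> \<in> sum_cone C"
    unfolding emb_def using root_in_root_space[OF assms] nn alpha_C
    by (intro sum_cone_sum sum_cone_scaleR sum_cone_base) (auto simp: root_space_def)
  then show "emb \<psi> \<in> C" using C_cone emb_root[OF assms] by blast
next
  assume C: "emb \<psi> \<in> C"
  obtain u s where u: "u \<in> lists I" "s \<in> I" "\<psi> = word_act cox_mat u (simple_root s)"
    using assms by (rule rootE)
  have "act u (\<alpha> s) \<in> C"
    using C emb_word_act[OF u(1) simple_root_in_root_space[OF u(2)]]
    by (simp add: u(3) emb_simple_root)
  then have "0 \<le> \<psi> r" for r unfolding u(3) by (rule word_act_simple_root_nonneg[OF u(1,2)])
  then show "\<psi> \<in> pos_roots" using assms by (simp add: coxeter_pos_roots_def)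
qed

lemma pos_root_root: "\<psi> \<in> pos_roots \<Longrightarrow> \<psi> \<in> roots"
  by (simp add: coxeter_pos_roots_def)

lemma inversions_class:
  assumes u: "u \<in> lists I"
  shows "inversions I cox_mat (coxeter_class I cox_mat u) = {\<psi> \<in> pos_roots. emb \<psi> \<notin> act u ` C}"
proof -
  have r: "rev u \<in> lists I" using u by auto
  have "(\<lambda>s. - word_act cox_mat (rev u) \<psi> s) \<in> pos_roots \<longleftrightarrow> emb \<psi> \<notin> act u ` C"
    if "\<psi> \<in> pos_roots" for \<psi>
  proof -
    have \<psi>: "\<psi> \<in> roots" "\<psi> \<in> root_space"
      using that pos_root_root root_in_root_space by blast+
    have w: "word_act cox_mat (rev u) \<psi> \<in> roots" by (rule word_act_root[OF r \<psi>(1)])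
    have "(\<lambda>s. - word_act cox_mat (rev u) \<psi> s) \<in> pos_roots \<longleftrightarrow> - act (rev u) (emb \<psi>) \<in> C"
      using pos_root_iff[OF uminus_root[OF w]] emb_minus[OF root_in_root_space[OF w]]
        emb_word_act[OF r \<psi>(2)] by simp
    then show ?thesis
      using C_uminus[OF act_U[OF r emb_root[OF \<psi>(1)]]] mem_act_image[OF u] by simp
  qed
  moreover have "coxeter_act cox_mat (coxeter_class I cox_mat (rev u)) \<psi> = word_act cox_mat (rev u) \<psi>"
    if "\<psi> \<in> pos_roots" for \<psi>
    using coxeter_act_class[OF r] that pos_root_root root_in_root_space by blast
  ultimately show ?thesis
    unfolding inversions_def inv_coxeter_class[OF coxeter_matrix_cox_mat u] by auto
qed

text \<open>At the letter where the gallery drops x, this root is the wall being crossed, so it is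
  the image of a simple root.\<close>

lemma inversion_is_root:
  assumes "u \<in> lists I" "x \<in> C" "x \<notin> act u ` C"
  shows "\<exists>\<psi>\<in>pos_roots. emb \<psi> = x"
  using assms
proof (induction u rule: rev_induct)
  case (snoc s u)
  then have us: "u \<in> lists I" "s \<in> I" by auto
  show ?case
  proof (cases "x \<in> act u ` C")
    case True
    then have x: "x = act u (\<alpha> s)" using snoc.prems unfolding act_snoc_image[OF us] by blast
    let ?\<psi> = "word_act cox_mat u (simple_root s)"
    have "emb ?\<psi> = x"
      using emb_word_act[OF us(1) simple_root_in_root_space[OF us(2)]] x
      by (simp add: emb_simple_root)
    then show ?thesis using pos_root_iff[OF rootI[OF us]] snoc.prems by blast
  next
    case False
    then show ?thesis using snoc us by blast
  qed
qed simp

section \<open>Blocks and twisted weak orders\<close>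

text \<open>Equal images mean that \<open>rev u @ v\<close> fixes \<open>C\<close>, which
  \<open>stabilizer_trivial\<close> turns into a relation between words.\<close>

lemma act_image_eq_iff:
  assumes u: "u \<in> lists I" and v: "v \<in> lists I"
  shows "act u ` C = act v ` C \<longleftrightarrow> (u, v) \<in> coxeter_rel I cox_mat"
proof
  assume eq: "act u ` C = act v ` C"
  have r: "rev u \<in> lists I" using u by auto
  have "act (rev u @ v) ` C = act (rev u) ` act u ` C" unfolding act_append_image eq ..
  also have "\<dots> = C" by (simp add: image_image act_rev_act[OF u])
  finally have "(rev u @ v, []) \<in> coxeter_rel I cox_mat"
    using stabilizer_trivial[of "rev u @ v"] r v by simp
  then have "(u @ (rev u @ v), u @ []) \<in> coxeter_rel I cox_mat"
    by (intro coxeter_rel_append coxeter_rel_refl u)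
  moreover have "((u @ rev u) @ v, [] @ v) \<in> coxeter_rel I cox_mat"
    by (intro coxeter_rel_append coxeter_rel_refl coxeter_rel_rev[OF coxeter_matrix_cox_mat] u v)
  ultimately show "(u, v) \<in> coxeter_rel I cox_mat"
    using coxeter_rel_sym coxeter_rel_trans by fastforce
qed (simp add: act_coxeter_rel)

text \<open>The complement of \<open>H\<close> is -H, so both are closed under cones, and
  \<open>emb\<close> is linear. As \<open>H\<close> may lie in another block, the set can be
  infinite; for \<open>H\<close> equal to \<open>C\<close> it is empty and the order is the ordinary
  weak order.\<close>

lemma root_biclosed_complement:
  assumes H: "H \<in> hemispaces U"
  shows "root_biclosed I cox_mat {\<psi> \<in> pos_roots. emb \<psi> \<notin> H}"
proof -
  have comb: "(\<lambda>s. k * a s + l * b s) \<in> pos_roots \<and>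
      emb (\<lambda>s. k * a s + l * b s) = k *\<^sub>R emb a + l *\<^sub>R emb b"
    if "a \<in> pos_roots" "b \<in> pos_roots" "0 \<le> k" "0 \<le> l" "(\<lambda>s. k * a s + l * b s) \<in> roots"
    for a b k l
    using that emb_comb[OF root_in_root_space root_in_root_space, of a b k l]
    by (auto simp: coxeter_pos_roots_def)
  have closed_H: "emb (\<lambda>s. k * a s + l * b s) \<in> H"
    if "a \<in> pos_roots" "b \<in> pos_roots" "0 \<le> k" "0 \<le> l" "(\<lambda>s. k * a s + l * b s) \<in> roots"
      "emb a \<in> H" "emb b \<in> H" for a b k l
  proof (rule hemispace_cone[OF H _ emb_root[OF that(5)]])
    show "emb (\<lambda>s. k * a s + l * b s) \<in> sum_cone H"
      unfolding conjunct2[OF comb[OF that(1-5)]]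
      using that by (intro sum_cone_add sum_cone_scaleR sum_cone_base)
  qed
  have closed_not_H: "emb (\<lambda>s. k * a s + l * b s) \<notin> H"
    if "a \<in> pos_roots" "b \<in> pos_roots" "0 \<le> k" "0 \<le> l" "(\<lambda>s. k * a s + l * b s) \<in> roots"
      "emb a \<notin> H" "emb b \<notin> H" for a b k l
  proof -
    let ?x = "emb (\<lambda>s. k * a s + l * b s)"
    have "- emb a \<in> H" "- emb b \<in> H"
      using that hemispace_uminus_iff[OF H emb_root] pos_root_root by blast+
    then have "k *\<^sub>R (- emb a) + l *\<^sub>R (- emb b) \<in> sum_cone H"
      using that by (intro sum_cone_add sum_cone_scaleR sum_cone_base)
    then have "- ?x \<in> sum_cone H" unfolding conjunct2[OF comb[OF that(1-5)]] by simp
    then have "- ?x \<in> H"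
      using hemispace_cone[OF H] hemispace_uminus_ground[OF H emb_root[OF that(5)]] by blast
    then show ?thesis using hemispace_uminus_iff[OF H emb_root[OF that(5)]] by blast
  qed
  show ?thesis
    unfolding root_biclosed_def root_closed_def
  proof (intro conjI ballI allI impI)
    fix a b and k l :: real
    assume k: "0 \<le> k" "0 \<le> l" and r: "(\<lambda>s. k * a s + l * b s) \<in> roots"
    {
      assume "a \<in> {\<psi> \<in> pos_roots. emb \<psi> \<notin> H}" "b \<in> {\<psi> \<in> pos_roots. emb \<psi> \<notin> H}"
      then have "a \<in> pos_roots" "b \<in> pos_roots" "emb a \<notin> H" "emb b \<notin> H" by simp_all
      then show "(\<lambda>s. k * a s + l * b s) \<in> {\<psi> \<in> pos_roots. emb \<psi> \<notin> H}"
        using comb[OF _ _ k r] closed_not_H[OF _ _ k r] by simp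
    next
      assume "a \<in> pos_roots - {\<psi> \<in> pos_roots. emb \<psi> \<notin> H}"
        "b \<in> pos_roots - {\<psi> \<in> pos_roots. emb \<psi> \<notin> H}"
      then have "a \<in> pos_roots" "b \<in> pos_roots" "emb a \<in> H" "emb b \<in> H" by simp_all
      then show "(\<lambda>s. k * a s + l * b s) \<in> pos_roots - {\<psi> \<in> pos_roots. emb \<psi> \<notin> H}"
        using comb[OF _ _ k r] closed_H[OF _ _ k r] by simp
    }
  qed (auto dest: pos_root_root)
qed

lemma tope_le_iff_twisted_le:
  assumes H: "H \<in> hemispaces U" and u: "u \<in> lists I" and v: "v \<in> lists I"
  shows "tope_le H (act u ` C) (act v ` C) \<longleftrightarrow>
    twisted_le I cox_mat {\<psi> \<in> pos_roots. emb \<psi> \<notin> H} (coxeter_class I cox_mat u) (coxeter_class I cox_mat v)"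
proof -
  let ?F = "act u ` C" and ?G = "act v ` C"
  have hemi: "?F \<in> hemispaces U" "?G \<in> hemispaces U" using act_C_hemispace u v by auto
  have tw: "twisted_le I cox_mat {\<psi> \<in> pos_roots. emb \<psi> \<notin> H}
        (coxeter_class I cox_mat u) (coxeter_class I cox_mat v) \<longleftrightarrow>
      (\<forall>\<psi>\<in>pos_roots. (emb \<psi> \<notin> ?F \<and> emb \<psi> \<in> ?G \<longrightarrow> emb \<psi> \<notin> H) \<and>
         (emb \<psi> \<in> ?F \<and> emb \<psi> \<notin> ?G \<longrightarrow> emb \<psi> \<in> H))"
    unfolding twisted_le_def inversions_class[OF u] inversions_class[OF v] by blast
  \<comment> \<open>Read pointwise: from the first hemispace to the second, only roots outside
    \<open>H\<close> are gained and only roots of \<open>H\<close> are lost.\<close>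
  have tope: "tope_le H ?F ?G \<longleftrightarrow>
      (\<forall>x\<in>U. (x \<notin> ?F \<and> x \<in> ?G \<longrightarrow> x \<notin> H) \<and> (x \<in> ?F \<and> x \<notin> ?G \<longrightarrow> x \<in> H))"
    using hemispace_subset[OF H] hemispace_subset[OF hemi(1)] hemispace_subset[OF hemi(2)]
    unfolding tope_le_def by blast
  show ?thesis
  proof
    assume "tope_le H ?F ?G"
    then show "twisted_le I cox_mat {\<psi> \<in> pos_roots. emb \<psi> \<notin> H}
        (coxeter_class I cox_mat u) (coxeter_class I cox_mat v)"
      unfolding tw tope using emb_root pos_root_root by blast
  next
    assume tw_le: "twisted_le I cox_mat {\<psi> \<in> pos_roots. emb \<psi> \<notin> H}
        (coxeter_class I cox_mat u) (coxeter_class I cox_mat v)"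
    have le: "(x \<notin> ?F \<and> x \<in> ?G \<longrightarrow> x \<notin> H) \<and> (x \<in> ?F \<and> x \<notin> ?G \<longrightarrow> x \<in> H)"
      if x: "x \<in> C" for x
    \<comment> \<open>A root of \<open>C\<close> in both hemispaces is subject to no condition; any
      other comes from a positive root of W'.\<close>
    proof (cases "x \<in> ?F \<and> x \<in> ?G")
      case False
      then have "\<exists>\<psi>\<in>pos_roots. emb \<psi> = x"
        using inversion_is_root[OF u x] inversion_is_root[OF v x] by auto
      then obtain \<psi> where "\<psi> \<in> pos_roots" "emb \<psi> = x" by (elim bexE)
      with bspec[OF tw_le[unfolded tw], of \<psi>] show ?thesis by simp
    qed simp
    \<comment> \<open>Negating x exchanges the two implications, so the roots of \<open>C\<close>
      decide.\<close>
    have "(x \<notin> ?F \<and> x \<in> ?G \<longrightarrow> x \<notin> H) \<and> (x \<in> ?F \<and> x \<notin> ?G \<longrightarrow> x \<in> H)"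
      if x: "x \<in> U" for x
    proof (cases "x \<in> C")
      case False
      then have "- x \<in> C" using C_uminus[OF x] by blast
      from le[OF this] show ?thesis
        using hemispace_uminus_iff[OF hemi(1) x] hemispace_uminus_iff[OF hemi(2) x]
          hemispace_uminus_iff[OF H x] by blast
    qed (rule le)
    then show "tope_le H ?F ?G" unfolding tope by blast
  qed
qed

theorem block_isomorphic_twisted:
  assumes H: "H \<in> hemispaces U"
  shows "poset_isomorphic {F \<in> hemispaces U. finite (C - F)} (tope_le H)
    (carrier (coxeter_group I cox_mat)) (twisted_le I cox_mat {\<psi> \<in> pos_roots. emb \<psi> \<notin> H})"
proof -
  let ?P = "{F \<in> hemispaces U. finite (C - F)}"
  define word where "word F = (SOME u. u \<in> lists I \<and> F = act u ` C)" for F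
  have word: "word F \<in> lists I" "F = act (word F) ` C" if "F \<in> ?P" for F
    using someI_ex[of "\<lambda>u. u \<in> lists I \<and> F = act u ` C"] hemispace_orbit[of F] that
    unfolding word_def by blast+
  let ?f = "\<lambda>F. coxeter_class I cox_mat (word F)"
  have "bij_betw ?f ?P (carrier (coxeter_group I cox_mat))"
  proof (rule bij_betw_imageI)
    show "inj_on ?f ?P"
    proof (rule inj_onI)
      fix F G assume F: "F \<in> ?P" and G: "G \<in> ?P" and eq: "?f F = ?f G"
      have "(word F, word G) \<in> coxeter_rel I cox_mat"
        using coxeter_class_eq_iff[OF word(1)[OF F] word(1)[OF G]] eq by blast
      then have "act (word F) ` C = act (word G) ` C"
        using act_image_eq_iff[OF word(1)[OF F] word(1)[OF G]] by blast
      then show "F = G" using word(2)[OF F] word(2)[OF G] by simp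
    qed
    show "?f ` ?P = carrier (coxeter_group I cox_mat)"
    proof
      show "?f ` ?P \<subseteq> carrier (coxeter_group I cox_mat)"
        by (rule image_subsetI) (rule coxeter_class_carrier[OF word(1)])
      show "carrier (coxeter_group I cox_mat) \<subseteq> ?f ` ?P"
      proof
        fix x assume "x \<in> carrier (coxeter_group I cox_mat)"
        then obtain u where u: "u \<in> lists I" "x = coxeter_class I cox_mat u"
          by (rule coxeter_group_carrierE)
        have F: "act u ` C \<in> ?P" using act_C_hemispace[OF u(1)] finite_inversions[OF u(1)] by blast
        have "(u, word (act u ` C)) \<in> coxeter_rel I cox_mat"
          using act_image_eq_iff[OF u(1) word(1)[OF F]] word(2)[OF F] by blast
        then have "x = ?f (act u ` C)"
          using coxeter_class_eq_iff[OF u(1) word(1)[OF F]] u(2) by blast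
        then show "x \<in> ?f ` ?P" using F by blast
      qed
    qed
  qed
  moreover have "tope_le H F G \<longleftrightarrow> twisted_le I cox_mat {\<psi> \<in> pos_roots. emb \<psi> \<notin> H} (?f F) (?f G)"
    if "F \<in> ?P" "G \<in> ?P" for F G
    using tope_le_iff_twisted_le[OF H word(1)[OF that(1)] word(1)[OF that(2)]]
      word(2)[OF that(1)] word(2)[OF that(2)] by simp
  ultimately show ?thesis unfolding poset_isomorphic_def by blast
qed

end

section \<open>Affine roots of unit length\<close>

text \<open>Positive factors change no cone, and injectivity keeps distinct roots from being
  merged.\<close>

lemma hemispace_rescale_iff:
  fixes k :: "'w::real_vector \<Rightarrow> real"
  defines "n \<equiv> \<lambda>x. k x *\<^sub>R x"
  assumes pos: "\<And>x. x \<in> E \<Longrightarrow> 0 < k x" and even: "\<And>x. k (- x) = k x"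
    and inj: "inj_on n E" and E: "\<And>x. x \<in> E \<Longrightarrow> - x \<in> E" and F: "F \<subseteq> E"
  shows "n ` F \<in> hemispaces (n ` E) \<longleftrightarrow> F \<in> hemispaces E"
proof -
  have minus: "n (- x) = - n x" for x by (simp add: n_def even)
  have mem: "n x \<in> n ` F \<longleftrightarrow> x \<in> F" if "x \<in> E" for x
    using inj_on_image_mem_iff[OF inj that F] .
  have n_cone: "n x \<in> sum_cone T \<longleftrightarrow> x \<in> sum_cone T" if x: "x \<in> E" for x T
  proof
    assume "n x \<in> sum_cone T"
    from sum_cone_scaleR[OF this, of "1 / k x"] show "x \<in> sum_cone T"
      using pos[OF x] by (simp add: n_def)
  next
    assume "x \<in> sum_cone T"
    then show "n x \<in> sum_cone T" using sum_cone_scaleR[of x T "k x"] pos[OF x] by (simp add: n_def)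
  qed
  have "n x \<in> sum_cone F" "x \<in> sum_cone (n ` F)" if "x \<in> F" for x
    using n_cone[of x F] n_cone[of x "n ` F"] F that sum_cone_base[of x F]
      sum_cone_base[of "n x" "n ` F"] by auto
  then have "n ` F \<subseteq> sum_cone F" "F \<subseteq> sum_cone (n ` F)" by auto
  then have cone: "sum_cone (n ` F) = sum_cone F"
    by (intro subset_antisym sum_cone_least)
  show ?thesis
  proof
    assume hemi: "n ` F \<in> hemispaces (n ` E)"
    show "F \<in> hemispaces E"
    proof (rule hemispacesI[OF F])
      fix x assume x: "x \<in> E"
      show "x \<in> F" if "x \<in> sum_cone F"
        using hemispace_cone[OF hemi, of "n x"] that x n_cone mem by (simp add: cone)
      show "- x \<in> E" using E[OF x] .
      show "- x \<in> F \<longleftrightarrow> x \<notin> F"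
        using hemispace_uminus_iff[OF hemi, of "n x"] mem[OF x] mem[OF E[OF x]] x minus by simp
    qed
  next
    assume hemi: "F \<in> hemispaces E"
    show "n ` F \<in> hemispaces (n ` E)"
    proof (rule hemispacesI)
      show "n ` F \<subseteq> n ` E" using F by blast
      fix y assume "y \<in> n ` E"
      then obtain x where x: "x \<in> E" "y = n x" by blast
      show "y \<in> n ` F" if "y \<in> sum_cone (n ` F)"
        using hemispace_cone[OF hemi _ x(1)] that n_cone[OF x(1)] mem[OF x(1)] x(2)
        by (simp add: cone)
      show "- y \<in> n ` E" using E[OF x(1)] x(2) minus by (metis imageI)
      show "- y \<in> n ` F \<longleftrightarrow> y \<notin> n ` F"
        using hemispace_uminus_iff[OF hemi x(1)] mem[OF x(1)] mem[OF E[OF x(1)]] x(2) minus by simp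
    qed
  qed
qed

lemma tope_le_image:
  assumes inj: "inj_on n E" and "H \<subseteq> E" "F \<subseteq> E" "G \<subseteq> E"
  shows "tope_le (n ` H) (n ` F) (n ` G) \<longleftrightarrow> tope_le H F G"
proof -
  have "sym_diff (n ` X) (n ` H) = n ` sym_diff X H" if "X \<subseteq> E" for X
    using inj_on_image_set_diff[OF inj, of X H] inj_on_image_set_diff[OF inj, of H X] that assms
    by (auto simp: image_Un)
  moreover have "n ` sym_diff F H \<subseteq> n ` sym_diff G H \<longleftrightarrow> sym_diff F H \<subseteq> sym_diff G H"
    using assms by (intro inj_on_image_subset_iff[OF inj]) auto
  ultimately show ?thesis using assms by (simp add: tope_le_def)
qed

lemma poset_isomorphic_compose:
  assumes "bij_betw n A A'" "\<And>x y. x \<in> A \<Longrightarrow> y \<in> A \<Longrightarrow> leA x y \<longleftrightarrow> leA' (n x) (n y)"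
    and "poset_isomorphic A' leA' B leB"
  shows "poset_isomorphic A leA B leB"
proof -
  obtain f where f: "bij_betw f A' B" "\<forall>x\<in>A'. \<forall>y\<in>A'. leA' x y \<longleftrightarrow> leB (f x) (f y)"
    using assms(3) unfolding poset_isomorphic_def by blast
  have "bij_betw (f \<circ> n) A B" using bij_betw_trans[OF assms(1) f(1)] .
  moreover have "leA x y \<longleftrightarrow> leB ((f \<circ> n) x) ((f \<circ> n) y)" if "x \<in> A" "y \<in> A" for x y
    using assms(2)[OF that] f(2) bij_betwE[OF assms(1)] that by simp
  ultimately show ?thesis unfolding poset_isomorphic_def by blast
qed

text \<open>The levels missing from \<open>root_hat\<close> at a are the negated levels at -a; the
  offset by one for negative roots makes the two halves fit without overlap.\<close>

lemma affine_roots_eq: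
  assumes \<Phi>: "crystallographic_root_system \<Phi>" and pos: "positive_system \<Phi> \<Phi>pos"
  shows "affine_roots \<Phi> \<Phi>pos = \<Phi> \<times> (\<int> :: real set)"
proof -
  have minus: "- a \<in> \<Phi>" if a: "a \<in> \<Phi>" for a
  proof -
    have "\<forall>c::real. c *\<^sub>R a \<in> \<Phi> \<longleftrightarrow> c = 1 \<or> c = -1"
      using \<Phi> a by (simp add: crystallographic_root_system_def)
    from spec[OF this, of "- 1"] show ?thesis by simp
  qed
  obtain v where v: "\<forall>a\<in>\<Phi>. v \<bullet> a \<noteq> 0" "\<Phi>pos = {a \<in> \<Phi>. v \<bullet> a > 0}"
    using pos by (auto simp: positive_system_def)
  have minus_pos: "- a \<in> \<Phi>pos \<longleftrightarrow> a \<notin> \<Phi>pos" if "a \<in> \<Phi>" for a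
    using v that minus[OF that] by (auto simp: not_less order.order_iff_strict)
  have hat: "(a, real_of_int i) \<in> affine_positive_roots \<Phi> \<Phi>pos \<longleftrightarrow>
      a \<in> \<Phi> \<and> (if a \<in> \<Phi>pos then 0 \<le> i else 1 \<le> i)" for a i
  proof -
    have "(\<exists>n. real_of_int i = real n) \<longleftrightarrow> 0 \<le> i"
      by (metis of_int_of_nat_eq of_int_eq_iff of_nat_0_le_iff nonneg_int_cases)
    moreover have "(\<exists>n. real_of_int i = real (n + 1)) \<longleftrightarrow> 1 \<le> i"
    proof
      assume "1 \<le> i"
      then have "real_of_int i = real (nat (i - 1) + 1)" by simp
      then show "\<exists>n. real_of_int i = real (n + 1)" by blast
    qed auto
    ultimately show ?thesis by (auto simp: affine_positive_roots_def root_hat_def)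
  qed
  have int: "snd x \<in> \<int>" if "x \<in> affine_positive_roots \<Phi> \<Phi>pos" for x
    using that by (auto simp: affine_positive_roots_def root_hat_def split: if_splits)
  have fst: "fst x \<in> \<Phi>" if "x \<in> affine_positive_roots \<Phi> \<Phi>pos" for x
    using that by (auto simp: affine_positive_roots_def root_hat_def split: if_splits)
  show ?thesis
  proof
    show "affine_roots \<Phi> \<Phi>pos \<subseteq> \<Phi> \<times> \<int>"
      using int fst minus by (fastforce simp: affine_roots_def)
    show "\<Phi> \<times> (\<int> :: real set) \<subseteq> affine_roots \<Phi> \<Phi>pos"
    proof
      fix x :: "'a \<times> real" assume "x \<in> \<Phi> \<times> \<int>"
      then obtain a i where x: "x = (a, real_of_int i)" "a \<in> \<Phi>" by (auto elim: Ints_cases)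
      show "x \<in> affine_roots \<Phi> \<Phi>pos"
      proof (cases "x \<in> affine_positive_roots \<Phi> \<Phi>pos")
        case False
        then have "(- a, real_of_int (- i)) \<in> affine_positive_roots \<Phi> \<Phi>pos"
          using x hat[of a i] hat[of "- a" "- i"] minus minus_pos[OF x(2)] by (auto split: if_splits)
        then have "- (- a, real_of_int (- i)) \<in> uminus ` affine_positive_roots \<Phi> \<Phi>pos" by (rule imageI)
        then show ?thesis using x by (simp add: affine_roots_def)
      qed (simp add: affine_roots_def)
    qed
  qed
qed

text \<open>Length is measured in V only; the coefficient of \<delta> is divided along with the root
  and need no longer be an integer.\<close>

definition normalize_root :: "'v::euclidean_space \<times> real \<Rightarrow> 'v \<times> real" where
  "normalize_root x = (1 / norm (fst x)) *\<^sub>R x"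

context
  fixes \<Phi> :: "'v::euclidean_space set"
  assumes root_system: "crystallographic_root_system \<Phi>"
begin

lemma root_nonzero: "a \<in> \<Phi> \<Longrightarrow> a \<noteq> 0"
  using root_system by (auto simp: crystallographic_root_system_def)

lemma root_reflection_root: "a \<in> \<Phi> \<Longrightarrow> b \<in> \<Phi> \<Longrightarrow> root_reflection a b \<in> \<Phi>"
  using root_system by (auto simp: crystallographic_root_system_def)

lemma root_integer: "a \<in> \<Phi> \<Longrightarrow> b \<in> \<Phi> \<Longrightarrow> 2 * (b \<bullet> a) / (a \<bullet> a) \<in> \<int>"
  using root_system by (auto simp: crystallographic_root_system_def)

lemma root_multiple: "a \<in> \<Phi> \<Longrightarrow> c *\<^sub>R a \<in> \<Phi> \<longleftrightarrow> c = 1 \<or> c = - 1"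
  using root_system by (auto simp: crystallographic_root_system_def)

lemma norm_root_reflection:
  assumes "a \<noteq> 0"
  shows "norm (root_reflection a b) = norm b"
proof -
  have "root_reflection a b \<bullet> root_reflection a b = b \<bullet> b"
    using assms by (simp add: root_reflection_def inner_diff_left inner_diff_right inner_commute[of a b]
        field_simps)
  then show ?thesis by (simp add: norm_eq_sqrt_inner)
qed

lemma inj_on_normalize_root: "inj_on normalize_root (\<Phi> \<times> \<int>)"
proof (rule inj_onI)
  fix x y assume x: "x \<in> \<Phi> \<times> \<int>" and y: "y \<in> \<Phi> \<times> \<int>"
    and eq: "normalize_root x = normalize_root y"
  have nz: "norm (fst x) > 0" "norm (fst y) > 0" using x y root_nonzero by auto
  define c where "c = norm (fst y) / norm (fst x)"
  have "y = norm (fst y) *\<^sub>R normalize_root x" unfolding eq using nz by (simp add: normalize_root_def)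
  then have c: "y = c *\<^sub>R x" by (simp add: normalize_root_def c_def)
  then have "fst y = c *\<^sub>R fst x" by simp
  then have "c *\<^sub>R fst x \<in> \<Phi>" using y by (metis mem_Times_iff)
  moreover have "c > 0" using nz by (simp add: c_def)
  ultimately have "c = 1" using root_multiple[of "fst x" c] x by auto
  then show "x = y" using c by simp
qed

text \<open>The reflection in (a, i) sends (b, j) to (b - k a, j - k i) with k a Cartan integer, so
  integral levels survive. The bond values are products of two Cartan integers, bounded by 4 through
  Cauchy-Schwarz.\<close>

lemma unit_root_system_affine:
  "unit_root_system (\<lambda>x y. fst x \<bullet> fst y) (normalize_root ` (\<Phi> \<times> \<int>))"
proof
  show "fst u \<bullet> fst u = 1" if "u \<in> normalize_root ` (\<Phi> \<times> \<int>)" for u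
    using that root_nonzero by (auto simp: normalize_root_def dot_square_norm power2_eq_square)
  show "v - (2 * (fst v \<bullet> fst u)) *\<^sub>R u \<in> normalize_root ` (\<Phi> \<times> \<int>)"
    if uv: "u \<in> normalize_root ` (\<Phi> \<times> \<int>)" "v \<in> normalize_root ` (\<Phi> \<times> \<int>)" for u v
  proof -
    obtain a i where u: "a \<in> \<Phi>" "i \<in> \<int>" "u = normalize_root (a, i)" using uv(1) by blast
    obtain b j where v: "b \<in> \<Phi>" "j \<in> \<int>" "v = normalize_root (b, j)" using uv(2) by blast
    have nz: "a \<noteq> 0" "b \<noteq> 0" using u v root_nonzero by auto
    define k where "k = 2 * (b \<bullet> a) / (a \<bullet> a)"
    let ?x = "(root_reflection a b, j - k * i)"
    have "?x \<in> \<Phi> \<times> \<int>"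
      using root_reflection_root[OF u(1) v(1)] Ints_mult[OF root_integer[OF u(1) v(1)] u(2)] v(2)
      by (simp add: k_def)
    moreover have "normalize_root ?x = v - (2 * (fst v \<bullet> fst u)) *\<^sub>R u"
    proof -
      have "2 * (fst v \<bullet> fst u) * (1 / norm a) = k * (1 / norm b)"
        using nz by (simp add: u v normalize_root_def k_def dot_square_norm power2_eq_square)
      then have "(2 * (fst v \<bullet> fst u)) *\<^sub>R u = (1 / norm b) *\<^sub>R k *\<^sub>R (a, i)"
        by (simp only: u(3) normalize_root_def fst_conv scaleR_scaleR mult.commute)
      moreover have "normalize_root ?x = (1 / norm b) *\<^sub>R ((b, j) - k *\<^sub>R (a, i))"
        using norm_root_reflection[OF nz(1), of b]
        by (simp add: normalize_root_def root_reflection_def k_def)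
      moreover have "v = (1 / norm b) *\<^sub>R (b, j)" by (simp add: v(3) normalize_root_def)
      ultimately show ?thesis by (simp only: scaleR_diff_right)
    qed
    ultimately show ?thesis by (metis imageI)
  qed
  show "4 * (fst u \<bullet> fst v)\<^sup>2 \<in> {0, 1, 2, 3, 4}"
    if uv: "u \<in> normalize_root ` (\<Phi> \<times> \<int>)" "v \<in> normalize_root ` (\<Phi> \<times> \<int>)" for u v
  proof -
    obtain a i where u: "a \<in> \<Phi>" "u = normalize_root (a, i)" using uv(1) by blast
    obtain b j where v: "b \<in> \<Phi>" "v = normalize_root (b, j)" using uv(2) by blast
    have nz: "a \<noteq> 0" "b \<noteq> 0" using u v root_nonzero by auto
    have eq: "4 * (fst u \<bullet> fst v)\<^sup>2 = (2 * (b \<bullet> a) / (a \<bullet> a)) * (2 * (a \<bullet> b) / (b \<bullet> b))"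
      using nz by (simp add: u v normalize_root_def inner_commute[of b a] dot_square_norm
          power2_eq_square)
    have "4 * (fst u \<bullet> fst v)\<^sup>2 \<in> \<int>"
      unfolding eq using root_integer u v by (intro Ints_mult) auto
    then obtain z where z: "4 * (fst u \<bullet> fst v)\<^sup>2 = of_int z" by (rule Ints_cases)
    have "\<bar>fst u \<bullet> fst v\<bar> \<le> norm (fst u) * norm (fst v)" by (rule Cauchy_Schwarz_ineq2)
    also have "\<dots> = 1" using nz by (simp add: u v normalize_root_def)
    finally have "(fst u \<bullet> fst v)\<^sup>2 \<le> 1" by (simp add: abs_square_le_1)
    then have "real_of_int z \<le> 4" "0 \<le> real_of_int z" unfolding z[symmetric] by simp_all
    then have "0 \<le> z" "z \<le> 4" by simp_all
    then consider "z = 0" | "z = 1" | "z = 2" | "z = 3" | "z = 4" by linarith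
    then show ?thesis using z by cases auto
  qed
qed (auto simp: inner_add_left inner_add_right inner_commute)

end

theorem corollary7p9:
  fixes \<Phi> \<Phi>pos :: "'v::euclidean_space set"
    and H :: "('v \<times> real) set"
    and P :: "('v \<times> real) set set"
  assumes "crystallographic_root_system \<Phi>"
    and "irreducible_root_system \<Phi>"
    and "positive_system \<Phi> \<Phi>pos"
    and "H \<in> hemispaces (affine_roots \<Phi> \<Phi>pos)"
    and "P \<in> blocks (affine_roots \<Phi> \<Phi>pos)"
  shows "\<exists>(I :: nat set) m B.
           coxeter_matrix I m \<and> root_biclosed I m B \<and>
           poset_isomorphic P (tope_le H) (carrier (coxeter_group I m)) (twisted_le I m B)"
proof -
  let ?E = "\<Phi> \<times> (\<int> :: real set)" and ?n = "normalize_root :: 'v \<times> real \<Rightarrow> _"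
  note E = affine_roots_eq[OF assms(1,3)]
  note inj = inj_on_normalize_root[OF assms(1)]
  have H: "H \<in> hemispaces ?E" using assms(4) E by simp
  obtain F\<^sub>0 where F\<^sub>0: "F\<^sub>0 \<in> hemispaces ?E" and P: "P = block_rel ?E `` {F\<^sub>0}"
    using assms(5) unfolding blocks_def E by (rule quotientE)
  have P_eq: "P = {F \<in> hemispaces ?E. finite (F\<^sub>0 - F)}"
    unfolding P block_rel_def using F\<^sub>0 hemispace_sym_diff_finite_iff[OF F\<^sub>0] by auto
  have hemi: "?n ` F \<in> hemispaces (?n ` ?E) \<longleftrightarrow> F \<in> hemispaces ?E" if "F \<subseteq> ?E" for F
    using hemispace_rescale_iff[of ?E "\<lambda>x. 1 / norm (fst x)" F] inj that
      root_nonzero[OF assms(1)] hemispace_uminus_ground[OF H]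
    unfolding normalize_root_def by auto
  \<comment> \<open>The base chamber is taken from the block itself; \<open>H\<close> may lie
    elsewhere and only determines the order.\<close>
  let ?C = "?n ` F\<^sub>0"
  have sub: "F \<subseteq> ?E" if "F \<in> hemispaces ?E" for F using hemispace_subset[OF that] .
  interpret chamber "\<lambda>x y. fst x \<bullet> fst y" "?n ` ?E" ?C
    using unit_root_system_affine[OF assms(1)] hemi[OF sub[OF F\<^sub>0]] F\<^sub>0
    by (simp add: chamber_def chamber_axioms_def)
  \<comment> \<open>Countability of the affine roots allows the simple ones to be named by natural
    numbers.\<close>
  have "countable \<Phi>"
    using assms(1) by (simp add: crystallographic_root_system_def countable_finite)
  moreover have "countable (\<int> :: real set)" by (simp add: Ints_def)
  ultimately have "countable (?n ` ?E)" by blast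
  then have "countable simple" using simple_U by (meson countable_subset subsetI)
  then have "bij_betw (to_nat_on simple) simple (to_nat_on simple ` simple)"
    using inj_on_to_nat_on inj_on_imp_bij_betw by blast
  then interpret simple_system "\<lambda>x y. fst x \<bullet> fst y" "?n ` ?E" ?C
      "to_nat_on simple ` simple" "inv_into simple (to_nat_on simple)"
    by unfold_locales (rule bij_betw_inv_into)
  let ?P = "{F \<in> hemispaces (?n ` ?E). finite (?C - F)}"
  have diff: "?C - ?n ` F = ?n ` (F\<^sub>0 - F)" if "F \<subseteq> ?E" for F
    using inj_on_image_set_diff[OF inj, of F\<^sub>0 F] that sub[OF F\<^sub>0] by auto
  have fin: "finite (?C - ?n ` F) \<longleftrightarrow> finite (F\<^sub>0 - F)" if "F \<subseteq> ?E" for F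
    unfolding diff[OF that] using sub[OF F\<^sub>0]
    by (intro finite_image_iff inj_on_subset[OF inj]) auto
  have "bij_betw (image ?n) P ?P"
  proof (rule bij_betw_imageI)
    show "inj_on (image ?n) P"
      using inj_on_image_eq_iff[OF inj] sub unfolding P_eq by (intro inj_onI) auto
    show "image ?n ` P = ?P"
    proof
      show "image ?n ` P \<subseteq> ?P" unfolding P_eq using hemi fin sub by auto
      show "?P \<subseteq> image ?n ` P"
      proof
        fix G assume G: "G \<in> ?P"
        then have "G \<subseteq> ?n ` ?E" using hemispace_subset by blast
        then obtain F where F: "F \<subseteq> ?E" "G = ?n ` F" by (rule subset_imageE)
        then have "F \<in> P" unfolding P_eq using G hemi fin by auto
        then show "G \<in> image ?n ` P" using F by blast
      qed
    qed
  qed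
  moreover have "tope_le H F G \<longleftrightarrow> tope_le (?n ` H) (?n ` F) (?n ` G)" if "F \<in> P" "G \<in> P" for F G
    using tope_le_image[OF inj, of H F G] sub H that unfolding P_eq by blast
  moreover have nH: "?n ` H \<in> hemispaces (?n ` ?E)" using hemi[OF sub[OF H]] H by blast
  ultimately have "poset_isomorphic P (tope_le H) (carrier (coxeter_group (to_nat_on simple ` simple) cox_mat))
      (twisted_le (to_nat_on simple ` simple) cox_mat {\<psi> \<in> pos_roots. emb \<psi> \<notin> ?n ` H})"
    by (rule poset_isomorphic_compose[OF _ _ block_isomorphic_twisted])
  then show ?thesis using coxeter_matrix_cox_mat root_biclosed_complement[OF nH] by blast
qed

end
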